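(* Let $g:\mathbb{S}^2_-\to\mathbb{S}^2_+$ be a smooth strictly length decreasing map, i.e. $|dg(w)|<|w|$ for every nonzero tangent vector $w$. For $x\in\mathbb{S}^2_-$ the 2-vector $x+g(x)\in\Lambda^2(\mathbb{R}^4)$ is a simple unit 2-vector and thus determines an oriented 2-plane $P(x)\subset\mathbb{R}^4$. Then the great circles $P(x)\cap\mathbb{S}^3$, $x\in\mathbb{S}^2_-$, are pairwise disjoint and cover $\mathbb{S}^3$; the unit vector field $\zeta$ tangent to them (oriented by the orientation of $P(x)$) is smooth on $\mathbb{S}^3$; and the map $\mathbb{S}^3\to\mathbb{S}^2_-$ sending $p$ to the unique $x$ with $p\in P(x)$ is a smooth submersion with totally geodesic fibers. Moreover, $\zeta$ is a Hopf vector field (equivalently this submersion is a Hopf fibration) if and only if $g$ is constant.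
   Context: $\mathbb{R}^4$ has orthonormal basis $(\varepsilon_1,\dots,\varepsilon_4)$. $\Lambda^2(\mathbb{R}^4)$ carries the inner product $(v_1\wedge v_2,w_1\wedge w_2)=\langle v_1,w_1\rangle\langle v_2,w_2\rangle-\langle v_1,w_2\rangle\langle v_2,w_1\rangle$. The Hodge star $*$ is the linear involution with $*(\varepsilon_1\wedge\varepsilon_2)=\varepsilon_3\wedge\varepsilon_4$, $*(\varepsilon_1\wedge\varepsilon_3)=-\varepsilon_2\wedge\varepsilon_4$, $*(\varepsilon_1\wedge\varepsilon_4)=\varepsilon_2\wedge\varepsilon_3$. $E_\pm=\{\omega:*\omega=\pm\omega\}$, $\mathbb{S}^2_\pm=\{\omega\in E_\pm:\|\omega\|=1/\sqrt2\}$ with the metrics induced from $\Lambda^2(\mathbb{R}^4)$. A simple unit 2-vector $v_1\wedge v_2$ ($v_1,v_2$ orthonormal) determines the oriented plane spanned by $(v_1,v_2)$. A Hopf vector field on $\mathbb{S}^3$ is one of the form $\zeta(p)=\mathcal{J}p$ with $\mathcal{J}\in O(4)$, $\mathcal{J}^2=-I$; a Hopf fibration is a submersion $\mathbb{S}^3\to\mathbb{S}^2$ whose fibers are the integral curves of a Hopf vector field. *)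

theory Defs
  imports "HOL-Analysis.Analysis"
begin

text \<open>R^4 is real^4 with the standard orthonormal basis eps 1, ..., eps 4.
  Lambda^2(R^4) is modelled by the antisymmetric 4x4 real matrices;
  v \<and> w is the matrix with entries v_i w_j - v_j w_i.\<close>

definition eps :: "4 \<Rightarrow> real^4" where
  "eps i = axis i 1"

definition wedge :: "real^4 \<Rightarrow> real^4 \<Rightarrow> real^4^4" where
  "wedge v w = (\<chi> i j. v$i * w$j - v$j * w$i)"

definition Lambda2 :: "(real^4^4) set" where
  "Lambda2 = {A. transpose A = - A}"

text \<open>The inner product of the paper: with this normalisation
  bv_inner (wedge v1 v2) (wedge w1 w2) = <v1,w1><v2,w2> - <v1,w2><v2,w1>.\<close>
definition bv_inner :: "real^4^4 \<Rightarrow> real^4^4 \<Rightarrow> real" where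
  "bv_inner A B = (\<Sum>i\<in>UNIV. \<Sum>j\<in>UNIV. A$i$j * B$i$j) / 2"

definition bv_norm :: "real^4^4 \<Rightarrow> real" where
  "bv_norm A = sqrt (bv_inner A A)"

definition hodge :: "real^4^4 \<Rightarrow> real^4^4" where
  "hodge A =
      A$1$2 *\<^sub>R wedge (eps 3) (eps 4)
    - A$1$3 *\<^sub>R wedge (eps 2) (eps 4)
    + A$1$4 *\<^sub>R wedge (eps 2) (eps 3)
    + A$2$3 *\<^sub>R wedge (eps 1) (eps 4)
    - A$2$4 *\<^sub>R wedge (eps 1) (eps 3)
    + A$3$4 *\<^sub>R wedge (eps 1) (eps 2)"

definition Eplus :: "(real^4^4) set" where
  "Eplus = {A \<in> Lambda2. hodge A = A}"

definition Eminus :: "(real^4^4) set" where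
  "Eminus = {A \<in> Lambda2. hodge A = - A}"

definition S2plus :: "(real^4^4) set" where
  "S2plus = {A \<in> Eplus. bv_norm A = 1 / sqrt 2}"

definition S2minus :: "(real^4^4) set" where
  "S2minus = {A \<in> Eminus. bv_norm A = 1 / sqrt 2}"

definition S3 :: "(real^4) set" where
  "S3 = sphere 0 1"

definition tan_S3 :: "real^4 \<Rightarrow> (real^4) set" where
  "tan_S3 p = {w. w \<bullet> p = 0}"

definition tan_S2minus :: "real^4^4 \<Rightarrow> (real^4^4) set" where
  "tan_S2minus x = {w \<in> Eminus. bv_inner w x = 0}"

definition simple_unit :: "real^4^4 \<Rightarrow> bool" where
  "simple_unit \<omega> \<longleftrightarrow> (\<exists>v1 v2. v1 \<bullet> v1 = 1 \<and> v2 \<bullet> v2 = 1 \<and> v1 \<bullet> v2 = 0 \<and> wedge v1 v2 = \<omega>)"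

definition plane :: "real^4^4 \<Rightarrow> (real^4) set" where
  "plane \<omega> = (SOME P. \<exists>v1 v2. v1 \<bullet> v1 = 1 \<and> v2 \<bullet> v2 = 1 \<and> v1 \<bullet> v2 = 0
                          \<and> wedge v1 v2 = \<omega> \<and> P = span {v1, v2})"

fun Ck_on :: "nat \<Rightarrow> 'a::euclidean_space set \<Rightarrow> ('a \<Rightarrow> real) \<Rightarrow> bool" where
  "Ck_on 0 U f \<longleftrightarrow> continuous_on U f"
| "Ck_on (Suc n) U f \<longleftrightarrow> continuous_on U f \<and>
     (\<forall>b\<in>Basis. \<exists>d. (\<forall>x\<in>U. ((\<lambda>t. f (x + t *\<^sub>R b)) has_real_derivative d x) (at 0))
                   \<and> Ck_on n U d)"

definition Cinf_on :: "'a::euclidean_space set \<Rightarrow> ('a \<Rightarrow> 'b::euclidean_space) \<Rightarrow> bool" where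
  "Cinf_on U f \<longleftrightarrow> open U \<and> (\<forall>b\<in>Basis. \<forall>n. Ck_on n U (\<lambda>x. f x \<bullet> b))"

definition smooth_map :: "'a::euclidean_space set \<Rightarrow> ('a \<Rightarrow> 'b::euclidean_space) \<Rightarrow> bool" where
  "smooth_map S f \<longleftrightarrow> (\<exists>U F. open U \<and> S \<subseteq> U \<and> Cinf_on U F \<and> (\<forall>x\<in>S. F x = f x))"

definition smooth_strictly_length_decreasing :: "(real^4^4 \<Rightarrow> real^4^4) \<Rightarrow> bool" where
  "smooth_strictly_length_decreasing g \<longleftrightarrow>
     (\<forall>x\<in>S2minus. g x \<in> S2plus) \<and>
     (\<exists>U G G'. open U \<and> S2minus \<subseteq> U \<and> Cinf_on U G \<and> (\<forall>x\<in>S2minus. G x = g x) \<and>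
        (\<forall>x\<in>U. (G has_derivative G' x) (at x)) \<and>
        (\<forall>x\<in>S2minus. \<forall>w\<in>tan_S2minus x. w \<noteq> 0 \<longrightarrow> bv_norm (G' x w) < bv_norm w))"

definition smooth_submersion :: "(real^4 \<Rightarrow> real^4^4) \<Rightarrow> bool" where
  "smooth_submersion \<pi> \<longleftrightarrow> \<pi> ` S3 \<subseteq> S2minus \<and>
     (\<exists>U P P'. open U \<and> S3 \<subseteq> U \<and> Cinf_on U P \<and> (\<forall>p\<in>S3. P p = \<pi> p) \<and>
        (\<forall>p\<in>U. (P has_derivative P' p) (at p)) \<and>
        (\<forall>p\<in>S3. P' p ` tan_S3 p = tan_S2minus (\<pi> p)))"

text \<open>Great circles of S^3 (the 1-dimensional complete connected totally geodesic submanifolds).\<close>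
definition great_circle :: "(real^4) set \<Rightarrow> bool" where
  "great_circle C \<longleftrightarrow> (\<exists>V. subspace V \<and> dim V = 2 \<and> C = V \<inter> S3)"

definition hopf_matrix :: "real^4^4 \<Rightarrow> bool" where
  "hopf_matrix J \<longleftrightarrow> orthogonal_matrix J \<and> J ** J = - mat 1"

definition hopf_vector_field :: "(real^4 \<Rightarrow> real^4) \<Rightarrow> bool" where
  "hopf_vector_field \<zeta> \<longleftrightarrow> (\<exists>J. hopf_matrix J \<and> (\<forall>p\<in>S3. \<zeta> p = J *v p))"

text \<open>A submersion onto S^2_- whose fibres are the integral curves
  t \<mapsto> cos t p + sin t Jp of a Hopf vector field p \<mapsto> Jp.\<close>
definition hopf_fibration :: "(real^4 \<Rightarrow> real^4^4) \<Rightarrow> bool" where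
  "hopf_fibration \<pi> \<longleftrightarrow> smooth_submersion \<pi> \<and>
     (\<exists>J. hopf_matrix J \<and>
        (\<forall>p\<in>S3. {q\<in>S3. \<pi> q = \<pi> p} = range (\<lambda>t. cos t *\<^sub>R p + sin t *\<^sub>R (J *v p))))"

definition gproj :: "(real^4^4 \<Rightarrow> real^4^4) \<Rightarrow> real^4 \<Rightarrow> real^4^4" where
  "gproj g p = (THE x. x \<in> S2minus \<and> p \<in> plane (x + g x))"

text \<open>Unit tangent vector to the great circle through p, oriented by P(x):
  (p, zeta p) is a positively oriented orthonormal basis of P(x).\<close>
definition gfield :: "(real^4^4 \<Rightarrow> real^4^4) \<Rightarrow> real^4 \<Rightarrow> real^4" where
  "gfield g p = (THE w. w \<bullet> p = 0 \<and> w \<bullet> w = 1 \<and> wedge p w = gproj g p + g (gproj g p))"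

end

theory Submission
  imports Defs
begin

text \<open>For a unit vector p, write x \<mapsto> rot p x for the isometry from self-dual to anti-self-dual
  2-vectors with im (rot p y) p = ip y p; in quaternionic terms it is a conjugation by p. Then p lies in
  the plane of x + g(x) iff x = rot p (g x), i.e. iff x is a fixed point of a strictly length decreasing
  self-map of the sphere. Such a map strictly decreases the spherical distance, so it has exactly one fixed
  point x = \<pi>(p); since 1 is not an eigenvalue of its derivative, the implicit function theorem makes \<pi>
  smooth, and \<zeta>(p) = -2 \<pi>(p) p. Writing \<zeta>(p) = J p, a matrix J with J J = -1 and
  J orthogonal is either anti-self-dual, which would make \<pi> constant, or self-dual, in which case
  g(\<pi>(p)) = -J/2 for all p.\<close>

section \<open>Smooth maps through iterated Frechet derivatives\<close>

text \<open>Smoothness on S^3 means having a smooth extension to an open set, so the construction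
  runs over all p \<noteq> 0 and not only over unit vectors. This is natural because the equation
  \<open>im x *v p = ip y *v p\<close> is linear in p: its solution x is constant along lines
  through the origin. The price is the factor \<open>(norm p)\<^sup>2\<close> carried by
  \<open>rot\<close>. Existence of the fixed point comes from metric geometry, so of the implicit
  function theorem only the regularity half remains. It applies to a solution already known to be
  continuous, since its graph is closed in a product with a compact sphere. \<open>Ck_on\<close>
  iterates partial derivatives, whereas a chain rule needs total ones. Regularity is therefore
  carried by \<open>Dk\<close>, which iterates Frechet derivatives. Evaluating them on basis vectors
  keeps the target type fixed at every order, so that inductions over the order can go
  through.\<close>

fun Dk :: "nat \<Rightarrow> 'a::euclidean_space set \<Rightarrow> ('a \<Rightarrow> 'b::real_normed_vector) \<Rightarrow> bool" where
  "Dk 0 U f \<longleftrightarrow> continuous_on U f"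
| "Dk (Suc n) U f \<longleftrightarrow>
     (\<exists>f'. (\<forall>x\<in>U. (f has_derivative f' x) (at x)) \<and> (\<forall>b\<in>Basis. Dk n U (\<lambda>x. f' x b)))"

lemma Dk_imp_continuous_on: "Dk n U f \<Longrightarrow> continuous_on U f"
  by (cases n) (auto intro!: continuous_at_imp_continuous_on dest: has_derivative_continuous)

lemma Dk_Suc_D: "Dk (Suc n) U f \<Longrightarrow> Dk n U f"
proof (induction n arbitrary: f)
  case 0
  then show ?case using Dk_imp_continuous_on by fastforce
next
  case (Suc n)
  then show ?case by (metis Dk.simps(2))
qed

lemma Dk_cong:
  assumes "open U" "\<And>x. x \<in> U \<Longrightarrow> f x = g x" "Dk n U f"
  shows "Dk n U g"
proof (cases n)
  case 0
  then show ?thesis using assms by (auto cong: continuous_on_cong)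
next
  case (Suc m)
  then obtain f' where f': "\<And>x. x \<in> U \<Longrightarrow> (f has_derivative f' x) (at x)"
      "\<And>b. b \<in> Basis \<Longrightarrow> Dk m U (\<lambda>x. f' x b)"
    using assms(3) by auto
  have "(g has_derivative f' x) (at x)" if "x \<in> U" for x
    using has_derivative_transform_within_open[OF f'(1)[OF that] assms(1) that assms(2)] by simp
  then show ?thesis using Suc f'(2) by auto
qed

lemma Dk_const [intro, simp]: "Dk n U (\<lambda>x. c)"
proof (induction n arbitrary: c)
  case (Suc n)
  then show ?case by (auto intro!: exI[of _ "\<lambda>x h. 0"])
qed auto

lemma Dk_linear:
  assumes "bounded_linear L" "Dk n U f"
  shows "Dk n U (\<lambda>x. L (f x))"
  using assms(2)
proof (induction n arbitrary: f)
  case 0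
  then show ?case
    using assms(1) linear_continuous_on_compose bounded_linear.continuous_on by auto
next
  case (Suc n)
  then obtain f' where f': "\<And>x. x \<in> U \<Longrightarrow> (f has_derivative f' x) (at x)"
      "\<And>b. b \<in> Basis \<Longrightarrow> Dk n U (\<lambda>x. f' x b)"
    by auto
  show ?case
    using Suc.IH f'(2) bounded_linear.has_derivative[OF assms(1) f'(1)]
    by (auto intro!: exI[of _ "\<lambda>x h. L (f' x h)"])
qed

lemma Dk_id [intro, simp]: "Dk n U (\<lambda>x. x)"
proof (cases n)
  case (Suc m)
  then show ?thesis by (auto intro!: exI[of _ "\<lambda>x h. h"])
qed auto

lemma Dk_add [intro]:
  assumes "Dk n U f" "Dk n U g"
  shows "Dk n U (\<lambda>x. f x + g x)"
  using assms
proof (induction n arbitrary: f g)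
  case 0
  then show ?case by (auto intro: continuous_on_add)
next
  case (Suc n)
  obtain f' where f': "\<And>x. x \<in> U \<Longrightarrow> (f has_derivative f' x) (at x)"
      "\<And>b. b \<in> Basis \<Longrightarrow> Dk n U (\<lambda>x. f' x b)"
    using Suc.prems(1) by auto
  obtain g' where g': "\<And>x. x \<in> U \<Longrightarrow> (g has_derivative g' x) (at x)"
      "\<And>b. b \<in> Basis \<Longrightarrow> Dk n U (\<lambda>x. g' x b)"
    using Suc.prems(2) by auto
  show ?case
    using f' g' Suc.IH has_derivative_add
    by (auto intro!: exI[of _ "\<lambda>x h. f' x h + g' x h"])
qed

lemma Dk_bilinear:
  assumes "bounded_bilinear B" "Dk n U f" "Dk n U g"
  shows "Dk n U (\<lambda>x. B (f x) (g x))"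
  using assms(2,3)
proof (induction n arbitrary: f g)
  case 0
  then show ?case by (auto intro: bounded_bilinear.continuous_on[OF assms(1)])
next
  case (Suc n)
  obtain f' where f': "\<And>x. x \<in> U \<Longrightarrow> (f has_derivative f' x) (at x)"
      "\<And>b. b \<in> Basis \<Longrightarrow> Dk n U (\<lambda>x. f' x b)"
    using Suc.prems(1) by auto
  obtain g' where g': "\<And>x. x \<in> U \<Longrightarrow> (g has_derivative g' x) (at x)"
      "\<And>b. b \<in> Basis \<Longrightarrow> Dk n U (\<lambda>x. g' x b)"
    using Suc.prems(2) by auto
  have "Dk n U f" "Dk n U g" using Suc.prems Dk_Suc_D by auto
  then have "Dk n U (\<lambda>x. B (f x) (g' x b) + B (f' x b) (g x))" if "b \<in> Basis" for b
    using f' g' Suc.IH that by auto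
  then show ?case
    using bounded_bilinear.FDERIV[OF assms(1) f'(1) g'(1)]
    by (auto intro!: exI[of _ "\<lambda>x h. B (f x) (g' x h) + B (f' x h) (g x)"])
qed

lemma Dk_uminus [intro]: "Dk n U f \<Longrightarrow> Dk n U (\<lambda>x. - f x)"
  using Dk_linear[OF bounded_linear_minus[OF bounded_linear_ident]] by blast

lemma Dk_diff [intro]: "Dk n U f \<Longrightarrow> Dk n U g \<Longrightarrow> Dk n U (\<lambda>x. f x - g x)"
  using Dk_add[of n U f "\<lambda>x. - g x"] by auto

lemma Dk_sum [intro]: "(\<And>i. i \<in> I \<Longrightarrow> Dk n U (f i)) \<Longrightarrow> Dk n U (\<lambda>x. \<Sum>i\<in>I. f i x)"
  by (induction I rule: infinite_finite_induct) auto

lemma Dk_scaleR [intro]: "Dk n U f \<Longrightarrow> Dk n U g \<Longrightarrow> Dk n U (\<lambda>x. f x *\<^sub>R g x)"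
  by (rule Dk_bilinear[OF bounded_bilinear_scaleR])

lemma Dk_mult [intro]:
  fixes f g :: "'a::euclidean_space \<Rightarrow> real"
  shows "Dk n U f \<Longrightarrow> Dk n U g \<Longrightarrow> Dk n U (\<lambda>x. f x * g x)"
  by (rule Dk_bilinear[OF bounded_bilinear_mult])

lemma Dk_inner [intro]: "Dk n U f \<Longrightarrow> Dk n U g \<Longrightarrow> Dk n U (\<lambda>x. f x \<bullet> g x)"
  by (rule Dk_bilinear[OF bounded_bilinear_inner])

lemma Dk_prod [intro]:
  fixes f :: "'i \<Rightarrow> 'a::euclidean_space \<Rightarrow> real"
  shows "(\<And>i. i \<in> I \<Longrightarrow> Dk n U (f i)) \<Longrightarrow> Dk n U (\<lambda>x. \<Prod>i\<in>I. f i x)"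
  by (induction I rule: infinite_finite_induct) auto

lemma Dk_componentwise:
  fixes f :: "'a::euclidean_space \<Rightarrow> 'b::euclidean_space"
  shows "Dk n U f \<longleftrightarrow> (\<forall>b\<in>Basis. Dk n U (\<lambda>x. f x \<bullet> b))"
proof
  assume "\<forall>b\<in>Basis. Dk n U (\<lambda>x. f x \<bullet> b)"
  then have "Dk n U (\<lambda>x. \<Sum>b\<in>Basis. (f x \<bullet> b) *\<^sub>R b)"
    by (intro Dk_sum Dk_scaleR Dk_const) blast
  then show "Dk n U f" by (simp add: euclidean_representation)
qed auto

lemma Dk_vec_nth [intro]: "Dk n U f \<Longrightarrow> Dk n U (\<lambda>x. f x $ i)"
  by (rule Dk_linear[OF bounded_linear_vec_nth])

lemma Dk_vec_lambda:
  fixes f :: "'a::euclidean_space \<Rightarrow> ('b::euclidean_space)^'n"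
  assumes "\<And>i. Dk n U (\<lambda>x. f x $ i)"
  shows "Dk n U f"
proof -
  have "Dk n U (\<lambda>x. f x \<bullet> b)" if b: "b \<in> Basis" for b
  proof -
    obtain i u where "b = axis i u" using b unfolding Basis_vec_def by blast
    then show ?thesis using Dk_inner[OF assms[of i] Dk_const[of n U u]] by (simp add: inner_axis)
  qed
  then show ?thesis by (subst Dk_componentwise) blast
qed

lemma Dk_Pair [intro]:
  assumes "Dk n U f" "Dk n U g"
  shows "Dk n U (\<lambda>x. (f x, g x))"
proof -
  have "bounded_linear (\<lambda>a. (a, 0::'c))" "bounded_linear (\<lambda>a. (0::'b, a))"
    by (auto intro!: bounded_linear_Pair bounded_linear_zero bounded_linear_ident)
  then have "Dk n U (\<lambda>x. (f x, 0) + (0, g x))"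
    by (intro Dk_add Dk_linear[of "\<lambda>a. (a, 0)"] Dk_linear[of "\<lambda>a. (0, a)"] assms)
  then show ?thesis by simp
qed

lemma Dk_compose:
  fixes f :: "'a::euclidean_space \<Rightarrow> 'b::euclidean_space" and g :: "'b \<Rightarrow> 'c::real_normed_vector"
  assumes "Dk n U f" "Dk n V g" "\<And>x. x \<in> U \<Longrightarrow> f x \<in> V"
  shows "Dk n U (\<lambda>x. g (f x))"
  using assms(1,2)
proof (induction n arbitrary: g)
  case 0
  then show ?case using assms(3) continuous_on_compose2 by (metis Dk.simps(1) image_subsetI)
next
  case (Suc n)
  obtain f' where f': "\<And>x. x \<in> U \<Longrightarrow> (f has_derivative f' x) (at x)"
      "\<And>b. b \<in> Basis \<Longrightarrow> Dk n U (\<lambda>x. f' x b)"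
    using Suc.prems(1) by auto
  obtain g' where g': "\<And>x. x \<in> V \<Longrightarrow> (g has_derivative g' x) (at x)"
      "\<And>b. b \<in> Basis \<Longrightarrow> Dk n V (\<lambda>x. g' x b)"
    using Suc.prems(2) by auto
  \<comment> \<open>\<open>Dk\<close> controls the derivative of g only on basis vectors, so g' at f
    x is expanded in the basis; each summand is then a scalar function times a composition covered
    by the induction hypothesis.\<close>
  define d where "d x h = (\<Sum>c\<in>Basis. (f' x h \<bullet> c) *\<^sub>R g' (f x) c)" for x h
  have d: "d x = (\<lambda>h. g' (f x) (f' x h))" if "x \<in> U" for x
  proof
    fix h
    have "linear (g' (f x))"
      using g'(1) assms(3)[OF that] has_derivative_linear by blast
    then have "(\<Sum>c\<in>Basis. (f' x h \<bullet> c) *\<^sub>R g' (f x) c) = g' (f x) (\<Sum>c\<in>Basis. (f' x h \<bullet> c) *\<^sub>R c)"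
      by (simp add: linear_sum linear_scale)
    then show "d x h = g' (f x) (f' x h)" by (simp add: d_def euclidean_representation)
  qed
  have "((\<lambda>x. g (f x)) has_derivative d x) (at x)" if "x \<in> U" for x
    unfolding d[OF that]
    by (rule has_derivative_compose[OF f'(1)[OF that] g'(1)[OF assms(3)[OF that]]])
  moreover have "Dk n U (\<lambda>x. d x b)" if "b \<in> Basis" for b
    unfolding d_def
    by (intro Dk_sum Dk_scaleR Dk_inner Dk_const f'(2)[OF that] Suc.IH[OF Dk_Suc_D[OF Suc.prems(1)] g'(2)])
  ultimately show ?case by auto
qed

lemma Dk_inverse:
  fixes f :: "'a::euclidean_space \<Rightarrow> real"
  assumes "Dk n U f" "\<And>x. x \<in> U \<Longrightarrow> f x \<noteq> 0"
  shows "Dk n U (\<lambda>x. inverse (f x))"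
proof -
  have "Dk n (-{0::real}) inverse"
  proof (induction n)
    case 0
    then show ?case by (auto intro: continuous_intros)
  next
    case (Suc n)
    have "(inverse has_derivative (\<lambda>h. - (inverse x * h * inverse x))) (at x)" if "x \<noteq> 0" for x :: real
      using has_derivative_inverse'[OF that, of UNIV] by simp
    moreover have "Dk n (-{0::real}) (\<lambda>x. - (inverse x * b * inverse x))" for b
      by (intro Dk_uminus Dk_mult Dk_const Suc)
    ultimately show ?case
      by (auto intro!: exI[of _ "\<lambda>x h. - (inverse x * h * inverse x)"])
  qed
  then show ?thesis using Dk_compose[OF assms(1), of "-{0}" inverse] assms(2) by auto
qed

lemma Dk_divide:
  fixes f g :: "'a::euclidean_space \<Rightarrow> real"
  assumes "Dk n U f" "Dk n U g" "\<And>x. x \<in> U \<Longrightarrow> g x \<noteq> 0"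
  shows "Dk n U (\<lambda>x. f x / g x)"
  unfolding divide_inverse by (intro Dk_mult Dk_inverse assms)

section \<open>From partial derivatives to Frechet derivatives\<close>

text \<open>The increment h is built up one coordinate at a time. Each new coordinate costs one
  application of the mean value theorem and half of the error allowance, paid for by the continuity
  of \<open>d b\<close> at x.\<close>

lemma continuous_partials_imp_has_derivative:
  fixes f :: "'a::euclidean_space \<Rightarrow> real"
  assumes "open U" "x \<in> U"
    and cont: "\<And>b. b \<in> Basis \<Longrightarrow> continuous_on U (d b)"
    and part: "\<And>b y. b \<in> Basis \<Longrightarrow> y \<in> U \<Longrightarrow>
                 ((\<lambda>t. f (y + t *\<^sub>R b)) has_real_derivative d b y) (at 0)"
  shows "(f has_derivative (\<lambda>h. \<Sum>b\<in>Basis. (h \<bullet> b) * d b x)) (at x)"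
proof -
  obtain r where r: "r > 0" "ball x r \<subseteq> U" using assms(1,2) openE by blast
  (* the base point y is allowed to move so that coordinates can be added one at a time *)
  have *: "\<forall>e>0. \<exists>\<delta>>0. \<forall>y h. dist y x < \<delta> \<longrightarrow> norm h < \<delta> \<longrightarrow>
            \<bar>f (y + (\<Sum>b\<in>B. (h \<bullet> b) *\<^sub>R b)) - f y - (\<Sum>b\<in>B. (h \<bullet> b) * d b x)\<bar> \<le> e * norm h"
    if "B \<subseteq> Basis" for B
    using finite_subset[OF that finite_Basis] that
  proof (induction B rule: finite_induct)
    case empty
    then show ?case by (auto intro: exI[of _ 1])
  next
    case (insert b B)
    show ?case
    proof (intro allI impI)
      fix e :: real assume "e > 0"
      then obtain \<delta>1 where \<delta>1: "\<delta>1 > 0" "\<And>y h. dist y x < \<delta>1 \<Longrightarrow> norm h < \<delta>1 \<Longrightarrow>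
         \<bar>f (y + (\<Sum>b\<in>B. (h \<bullet> b) *\<^sub>R b)) - f y - (\<Sum>b\<in>B. (h \<bullet> b) * d b x)\<bar> \<le> e/2 * norm h"
        using insert.IH insert.prems half_gt_zero by (meson insert_subset)
      have b: "b \<in> Basis" using insert.prems by auto
      have "isCont (d b) x"
        using cont[OF b] assms(1,2) continuous_on_eq_continuous_at by blast
      then obtain \<delta>2 where \<delta>2: "\<delta>2 > 0" "\<And>y. dist y x < \<delta>2 \<Longrightarrow> dist (d b y) (d b x) < e/2"
        using \<open>e > 0\<close> unfolding continuous_at_eps_delta by (meson half_gt_zero)
      \<comment> \<open>Halved because moving the base point along b can double its distance to
        x.\<close>
      define \<delta> where "\<delta> = Min {\<delta>1, \<delta>2, r} / 2"
      have \<delta>: "\<delta> > 0" "2 * \<delta> \<le> \<delta>1" "2 * \<delta> \<le> \<delta>2" "2 * \<delta> \<le> r"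
        using \<delta>1 \<delta>2 r by (auto simp: \<delta>_def)
      have "\<bar>f (y + (\<Sum>b\<in>insert b B. (h \<bullet> b) *\<^sub>R b)) - f y - (\<Sum>b\<in>insert b B. (h \<bullet> b) * d b x)\<bar> \<le> e * norm h"
        if y: "dist y x < \<delta>" and h: "norm h < \<delta>" for y h
      proof -
        define t where "t = h \<bullet> b"
        define y' where "y' = y + t *\<^sub>R b"
        have t: "\<bar>t\<bar> \<le> norm h" using Basis_le_norm[OF b] by (simp add: t_def)
        have near: "dist (y + s *\<^sub>R b) x < 2 * \<delta>" if "\<bar>s\<bar> \<le> \<bar>t\<bar>" for s
        proof -
          have "dist (y + s *\<^sub>R b) x \<le> dist y x + norm (s *\<^sub>R b)"
            by (metis add.commute dist_norm dist_triangle_le add_diff_cancel_left' order_refl dist_commute)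
          then show ?thesis using y h t that b by simp
        qed
        have "\<exists>s. \<bar>s\<bar> \<le> \<bar>t\<bar> \<and> f (y + t *\<^sub>R b) - f y = t * d b (y + s *\<^sub>R b)"
        proof -
          have der: "((\<lambda>s. f (y + s *\<^sub>R b)) has_real_derivative d b (y + s *\<^sub>R b)) (at s)"
            if "\<bar>s\<bar> \<le> \<bar>t\<bar>" for s
          proof -
            have "y + s *\<^sub>R b \<in> U"
              using near[OF that] \<delta>(4) r(2) by (metis dist_commute mem_ball order_less_le_trans subset_eq)
            then have "((\<lambda>u. f (y + s *\<^sub>R b + u *\<^sub>R b)) has_real_derivative d b (y + s *\<^sub>R b)) (at 0)"
              by (rule part[OF b])
            then have "((\<lambda>u. f (y + (u + s) *\<^sub>R b)) has_real_derivative d b (y + s *\<^sub>R b)) (at 0)"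
              by (simp add: algebra_simps)
            then show ?thesis
              using DERIV_shift[of "\<lambda>u. f (y + u *\<^sub>R b)" "d b (y + s *\<^sub>R b)" 0 s] by (simp add: add.commute)
          qed
          consider "t = 0" | "t > 0" | "t < 0" by linarith
          then show ?thesis
          proof cases
            case 1
            then show ?thesis by auto
          next
            case 2
            then show ?thesis
              using MVT2[of 0 t "\<lambda>s. f (y + s *\<^sub>R b)" "\<lambda>s. d b (y + s *\<^sub>R b)"] der by force
          next
            case 3
            then obtain z where "t < z" "z < 0" "f (y + 0 *\<^sub>R b) - f (y + t *\<^sub>R b) = (0 - t) * d b (y + z *\<^sub>R b)"
              using MVT2[of t 0 "\<lambda>s. f (y + s *\<^sub>R b)" "\<lambda>s. d b (y + s *\<^sub>R b)"] der by force
            then show ?thesis by (intro exI[of _ z]) (auto simp: algebra_simps)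
          qed
        qed
        then obtain s where s: "\<bar>s\<bar> \<le> \<bar>t\<bar>" "f y' - f y = t * d b (y + s *\<^sub>R b)"
          unfolding y'_def by blast
        have "\<bar>d b (y + s *\<^sub>R b) - d b x\<bar> < e/2"
          using \<delta>2(2)[of "y + s *\<^sub>R b"] near[OF s(1)] \<delta>(3) by (simp add: dist_real_def)
        then have "\<bar>t\<bar> * \<bar>d b (y + s *\<^sub>R b) - d b x\<bar> \<le> norm h * (e/2)"
          using t by (intro mult_mono) auto
        then have 1: "\<bar>f y' - f y - t * d b x\<bar> \<le> e/2 * norm h"
          unfolding s(2) by (simp add: right_diff_distrib[symmetric] abs_mult mult.commute)
        have "dist y' x < \<delta>1"
          using near[of t] \<delta>(2) by (simp add: y'_def)
        then have 2: "\<bar>f (y' + (\<Sum>b\<in>B. (h \<bullet> b) *\<^sub>R b)) - f y' - (\<Sum>b\<in>B. (h \<bullet> b) * d b x)\<bar> \<le> e/2 * norm h"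
          using \<delta>1(2) h \<delta> by force
        have 3: "y + (\<Sum>b\<in>insert b B. (h \<bullet> b) *\<^sub>R b) = y' + (\<Sum>b\<in>B. (h \<bullet> b) *\<^sub>R b)"
          "(\<Sum>b\<in>insert b B. (h \<bullet> b) * d b x) = t * d b x + (\<Sum>b\<in>B. (h \<bullet> b) * d b x)"
          using insert.hyps by (auto simp: y'_def t_def)
        show ?thesis unfolding 3 using 1 2 by linarith
      qed
      then show "\<exists>\<delta>>0. \<forall>y h. dist y x < \<delta> \<longrightarrow> norm h < \<delta> \<longrightarrow>
        \<bar>f (y + (\<Sum>b\<in>insert b B. (h \<bullet> b) *\<^sub>R b)) - f y - (\<Sum>b\<in>insert b B. (h \<bullet> b) * d b x)\<bar> \<le> e * norm h"
        using \<delta>(1) by blast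
    qed
  qed
  show ?thesis
    unfolding has_derivative_at_alt
  proof (intro conjI allI impI)
    show "bounded_linear (\<lambda>h. \<Sum>b\<in>Basis. (h \<bullet> b) * d b x)"
      by (intro bounded_linear_sum bounded_linear_mult_left[THEN bounded_linear_compose]
           bounded_linear_inner_left)
    fix e :: real assume "e > 0"
    then obtain \<delta> where \<delta>: "\<delta> > 0" "\<And>y h. dist y x < \<delta> \<Longrightarrow> norm h < \<delta> \<Longrightarrow>
       \<bar>f (y + (\<Sum>b\<in>Basis. (h \<bullet> b) *\<^sub>R b)) - f y - (\<Sum>b\<in>Basis. (h \<bullet> b) * d b x)\<bar> \<le> e * norm h"
      using *[OF order_refl] by meson
    show "\<exists>\<delta>>0. \<forall>y. norm (y - x) < \<delta> \<longrightarrow>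
        norm (f y - f x - (\<Sum>b\<in>Basis. ((y - x) \<bullet> b) * d b x)) \<le> e * norm (y - x)"
    proof (intro exI[of _ \<delta>] conjI allI impI)
      fix y assume "norm (y - x) < \<delta>"
      then show "norm (f y - f x - (\<Sum>b\<in>Basis. ((y - x) \<bullet> b) * d b x)) \<le> e * norm (y - x)"
        using \<delta>(2)[of x "y - x", unfolded euclidean_representation] \<delta>(1) by simp
    qed (rule \<delta>(1))
  qed
qed

lemma Ck_on_imp_Dk: "open U \<Longrightarrow> Ck_on n U f \<Longrightarrow> Dk n U f"
proof (induction n arbitrary: f)
  case (Suc n)
  then obtain d where d: "\<And>b y. b \<in> Basis \<Longrightarrow> y \<in> U \<Longrightarrow>
      ((\<lambda>t. f (y + t *\<^sub>R b)) has_real_derivative d b y) (at 0)"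
      "\<And>b. b \<in> Basis \<Longrightarrow> Ck_on n U (d b)"
    by simp metis
  have "continuous_on U (d b)" if "b \<in> Basis" for b
    using d(2)[OF that] by (cases n) auto
  then have "(f has_derivative (\<lambda>h. \<Sum>b\<in>Basis. (h \<bullet> b) * d b x)) (at x)" if "x \<in> U" for x
    using continuous_partials_imp_has_derivative[OF Suc.prems(1) that] d(1) by blast
  moreover have "(\<lambda>x. \<Sum>c\<in>Basis. (b \<bullet> c) * d c x) = d b" if "b \<in> Basis" for b
    using that by (auto simp: inner_Basis if_distrib[of "\<lambda>u. u * _"] sum.delta cong: if_cong)
  ultimately show ?case
    using Suc.IH[OF Suc.prems(1)] d(2)
    by (auto intro!: exI[of _ "\<lambda>x h. \<Sum>b\<in>Basis. (h \<bullet> b) * d b x"])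
qed auto

lemma Dk_imp_Ck_on: "Dk n U f \<Longrightarrow> Ck_on n U f"
proof (induction n arbitrary: f)
  case (Suc n)
  then obtain f' where f': "\<And>x. x \<in> U \<Longrightarrow> (f has_derivative f' x) (at x)"
      "\<And>b. b \<in> Basis \<Longrightarrow> Dk n U (\<lambda>x. f' x b)"
    by auto
  have "((\<lambda>t. f (x + t *\<^sub>R b)) has_real_derivative f' x b) (at 0)" if "x \<in> U" for x b
  proof -
    have "((\<lambda>t. x + t *\<^sub>R b) has_derivative (\<lambda>t. t *\<^sub>R b)) (at 0)"
      by (auto intro!: derivative_eq_intros)
    moreover have "(f has_derivative f' x) (at (x + 0 *\<^sub>R b))" using f'(1)[OF that] by simp
    ultimately have "((\<lambda>t. f (x + t *\<^sub>R b)) has_derivative (\<lambda>t. f' x (t *\<^sub>R b))) (at 0)"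
      by (rule has_derivative_compose)
    moreover have "f' x (t *\<^sub>R b) = f' x b * t" for t
      using has_derivative_linear[OF f'(1)[OF that]] by (simp add: linear_scale)
    ultimately show ?thesis by (simp add: has_field_derivative_def)
  qed
  then have "\<exists>d. (\<forall>x\<in>U. ((\<lambda>t. f (x + t *\<^sub>R b)) has_real_derivative d x) (at 0)) \<and> Ck_on n U d"
    if "b \<in> Basis" for b
    using Suc.IH[OF f'(2)[OF that]] \<open>\<And>x b. x \<in> U \<Longrightarrow> _\<close> by (intro exI[of _ "\<lambda>x. f' x b"]) simp
  then show ?case
    using Dk_imp_continuous_on[OF Suc.prems] by simp
qed auto

lemma Cinf_on_iff_Dk: "Cinf_on U f \<longleftrightarrow> open U \<and> (\<forall>n. Dk n U f)"
  unfolding Cinf_on_def using Ck_on_imp_Dk Dk_imp_Ck_on Dk_componentwise by metis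

section \<open>Smoothness of implicitly defined maps\<close>

text \<open>Continuity of u is assumed, so only the candidate \<open>u' h = - M (F' (h, 0))\<close>,
  with M the inverse of the partial derivative L, has to be checked. Applying M to the linearisation
  error r gives \<open>k - u' h = - M r\<close> for the increment k of u, and r is small compared
  with |h| + |k|. This first bounds |k| by a multiple of |h|, and that bound is then fed
  back.\<close>

lemma implicit_has_derivative:
  fixes F :: "'a::real_normed_vector \<times> 'b::euclidean_space \<Rightarrow> 'b"
  assumes F: "(F has_derivative F') (at (p, u p))"
    and u: "isCont u p"
    and zero: "eventually (\<lambda>q. F (q, u q) = 0) (nhds p)"
    and inj: "inj (\<lambda>k. F' (0, k))"
  shows "\<exists>u'. (u has_derivative u') (at p) \<and> (\<forall>h. F' (h, u' h) = 0)"
proof -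
  have lin: "linear F'" and bl: "bounded_linear F'"
    using F has_derivative_linear has_derivative_bounded_linear by auto
  define L where "L k = F' (0, k)" for k
  have L: "linear L"
    unfolding L_def using lin by (auto intro!: linearI simp: linear_add[symmetric] linear_scale[symmetric])
  have "inj L" using inj by (simp add: L_def[abs_def])
  then obtain M where M: "linear M" "M \<circ> L = id"
    using linear_injective_left_inverse[OF L] by auto
  then have LM: "L \<circ> M = id" using linear_inverse_left[OF M(1) L] by blast
  have blM: "bounded_linear M" using M(1) by (simp add: linear_conv_bounded_linear)
  define u' where "u' h = - M (F' (h, 0))" for h
  have blu: "bounded_linear u'"
    unfolding u'_def
    by (intro bounded_linear_minus bounded_linear_compose[OF blM] bounded_linear_compose[OF bl]
        bounded_linear_Pair bounded_linear_ident bounded_linear_zero)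
  have split: "F' (h, k) = F' (h, 0) + L k" for h k
    using linear_add[OF lin, of "(h, 0)" "(0, k)"] by (simp add: L_def)
  have *: "F' (h, u' h) = 0" for h
    using LM linear_neg[OF L] by (subst split) (simp add: u'_def o_def fun_eq_iff)
  obtain K where K: "K > 0" "\<And>v. norm (M v) \<le> norm v * K"
    using bounded_linear.pos_bounded[OF blM] by blast
  obtain C where C: "C > 0" "\<And>h. norm (u' h) \<le> norm h * C"
    using bounded_linear.pos_bounded[OF blu] by blast
  have "(u has_derivative u') (at p)"
    unfolding has_derivative_at_alt
  proof (intro conjI allI impI)
    show "bounded_linear u'" by (rule blu)
    fix e :: real assume e: "e > 0"
    \<comment> \<open>The first entry lets half of |k| be absorbed, which yields |k| \<le> (2 C + 1)
      |h|; the second then turns K \<epsilon> (|h| + |k|) into at most e |h|.\<close>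
    define \<epsilon> where "\<epsilon> = min (1 / (2 * K)) (e / (K * (2 * C + 2)))"
    have \<epsilon>: "\<epsilon> > 0" "K * \<epsilon> \<le> 1/2" "K * \<epsilon> * (2 * C + 2) \<le> e"
    proof -
      show "\<epsilon> > 0" using e K C by (simp add: \<epsilon>_def)
      have "K * \<epsilon> \<le> K * (1 / (2 * K))" using K by (intro mult_left_mono) (auto simp: \<epsilon>_def)
      then show "K * \<epsilon> \<le> 1/2" using K by simp
      have "K * (2 * C + 2) * \<epsilon> \<le> K * (2 * C + 2) * (e / (K * (2 * C + 2)))"
        using K C by (intro mult_left_mono) (auto simp: \<epsilon>_def)
      then show "K * \<epsilon> * (2 * C + 2) \<le> e" using K C by (simp add: mult_ac)
    qed
    obtain d where d: "d > 0" "\<And>z. norm (z - (p, u p)) < d \<Longrightarrow>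
        norm (F z - F (p, u p) - F' (z - (p, u p))) \<le> \<epsilon> * norm (z - (p, u p))"
      using F \<epsilon>(1) unfolding has_derivative_at_alt by blast
    obtain d1 where d1: "d1 > 0" "\<And>q. dist q p < d1 \<Longrightarrow> dist (u q) (u p) < d/2"
      using u d(1) unfolding continuous_at_eps_delta by (meson half_gt_zero)
    obtain d2 where d2: "d2 > 0" "\<And>q. dist q p < d2 \<Longrightarrow> F (q, u q) = 0"
      using zero unfolding eventually_nhds_metric by blast
    have "norm (u q - u p - u' (q - p)) \<le> e * norm (q - p)" if q: "norm (q - p) < min (d/2) (min d1 d2)" for q
    proof -
      define h k where "h = q - p" and "k = u q - u p"
      define r where "r = F (q, u q) - F (p, u p) - F' (h, k)"
      have hk: "norm (h, k) \<le> norm h + norm k" by (rule norm_Pair_le)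
      have "norm k < d/2" using d1(2)[of q] q by (simp add: k_def dist_norm)
      then have "norm (h, k) < d" using hk q by (simp add: h_def)
      then have "norm r \<le> \<epsilon> * norm (h, k)"
        using d(2)[of "(q, u q)"] by (simp add: r_def h_def k_def)
      then have r: "norm r \<le> \<epsilon> * (norm h + norm k)"
        using mult_left_mono[OF hk, of \<epsilon>] \<epsilon>(1) by linarith
      have "r = - (F' (h, 0) + L k)"
        using d2(2)[of q] d2(2)[of p] d2(1) q by (simp add: r_def split[of h k] dist_norm)
      then have "M r = u' h - M (L k)"
        using M(1) by (simp add: linear_neg linear_add linear_diff u'_def)
      then have kr: "k - u' h = - M r" using M(2) by (simp add: o_def fun_eq_iff)
      have "norm (k - u' h) \<le> norm r * K" using K(2)[of r] by (simp add: kr)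
      also have "\<dots> \<le> \<epsilon> * (norm h + norm k) * K" using r K(1) by (intro mult_right_mono) auto
      finally have 1: "norm (k - u' h) \<le> K * \<epsilon> * (norm h + norm k)" by (simp add: mult_ac)
      have "norm k \<le> norm (u' h) + norm (k - u' h)" by norm
      also have "\<dots> \<le> C * norm h + 1/2 * (norm h + norm k)"
        using C(2)[of h] 1 mult_right_mono[OF \<epsilon>(2), of "norm h + norm k"]
        by (smt (verit) mult.commute norm_ge_zero)
      finally have "norm k \<le> (2 * C + 1) * norm h" by (simp add: field_simps)
      then have "K * \<epsilon> * (norm h + norm k) \<le> K * \<epsilon> * ((2 * C + 2) * norm h)"
        using K(1) \<epsilon>(1) by (intro mult_left_mono) (auto simp: algebra_simps)
      also have "\<dots> \<le> e * norm h"
        using mult_right_mono[OF \<epsilon>(3), of "norm h"] by (simp add: mult_ac)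
      finally show ?thesis using 1 by (simp add: h_def k_def)
    qed
    then show "\<exists>d>0. \<forall>q. norm (q - p) < d \<longrightarrow> norm (u q - u p - u' (q - p)) \<le> e * norm (q - p)"
      using d d1 d2 by (intro exI[of _ "min (d/2) (min d1 d2)"]) auto
  qed
  then show ?thesis using * by blast
qed

text \<open>\<open>Dk\<close> hides its derivative behind an existential quantifier; uniqueness of
  the Frechet derivative transfers the regularity to a derivative F' fixed beforehand.\<close>

lemma Dk_partial:
  assumes "open W" "Dk (Suc n) W F" "\<And>z. z \<in> W \<Longrightarrow> (F has_derivative F' z) (at z)" "b \<in> Basis"
  shows "Dk n W (\<lambda>z. F' z b)"
proof -
  obtain G where G: "\<And>z. z \<in> W \<Longrightarrow> (F has_derivative G z) (at z)" "Dk n W (\<lambda>z. G z b)"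
    using assms(2,4) by auto
  show ?thesis
    using Dk_cong[OF assms(1) _ G(2)] has_derivative_unique[OF G(1) assms(3)] by metis
qed

lemma Dk_det:
  fixes A :: "'a::euclidean_space \<Rightarrow> real^'n^'n"
  assumes "\<And>i j. Dk n U (\<lambda>x. A x $ i $ j)"
  shows "Dk n U (\<lambda>x. det (A x))"
  unfolding det_def by (intro Dk_sum Dk_mult Dk_prod Dk_const assms)

(* Cramer's rule expresses u' through the partials of F at (p, u p), so u gains one derivative. *)
lemma implicit_Dk:
  fixes F :: "'a::euclidean_space \<times> (real^'n) \<Rightarrow> real^'n"
  assumes "open P" "open W" and F: "\<And>n. Dk n W F"
    and F': "\<And>z. z \<in> W \<Longrightarrow> (F has_derivative F' z) (at z)"
    and u: "continuous_on P u"
    and W: "\<And>p. p \<in> P \<Longrightarrow> (p, u p) \<in> W"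
    and zero: "\<And>p. p \<in> P \<Longrightarrow> F (p, u p) = 0"
    and inj: "\<And>p. p \<in> P \<Longrightarrow> inj (\<lambda>k. F' (p, u p) (0, k))"
  shows "Dk n P u"
proof -
  have "\<exists>u'. (u has_derivative u') (at p) \<and> (\<forall>h. F' (p, u p) (h, u' h) = 0)" if p: "p \<in> P" for p
  proof (rule implicit_has_derivative[where u = u, OF F'[OF W[OF p]] _ _ inj[OF p]])
    show "isCont u p" using u \<open>open P\<close> p continuous_on_eq_continuous_at by blast
    show "eventually (\<lambda>q. F (q, u q) = 0) (nhds p)"
      using zero \<open>open P\<close> p eventually_nhds by blast
  qed
  then obtain u' where u': "\<And>p. p \<in> P \<Longrightarrow> (u has_derivative u' p) (at p)"
      "\<And>p h. p \<in> P \<Longrightarrow> F' (p, u p) (h, u' p h) = 0"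
    by metis
  define A where "A p = matrix (\<lambda>k. F' (p, u p) (0, k))" for p
  have lin: "linear (F' (p, u p))" if "p \<in> P" for p
    using F'[OF W[OF that]] has_derivative_linear by blast
  have linL: "linear (\<lambda>k. F' (p, u p) (0, k))" if "p \<in> P" for p
    using lin[OF that] by (auto intro!: linearI simp: linear_add[symmetric] linear_scale[symmetric])
  have det: "det (A p) \<noteq> 0" if "p \<in> P" for p
    using det_nz_iff_inj[OF linL[OF that]] inj[OF that] by (simp add: A_def)
  define c where "c p h k = det (\<chi> i j. if j = k then - F' (p, u p) (h, 0) $ i else A p $ i $ j) / det (A p)" for p h k
  have u'_eq: "u' p h = (\<chi> k. c p h k)" if p: "p \<in> P" for p h
  proof -
    have "F' (p, u p) (h, 0) + F' (p, u p) (0, u' p h) = 0"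
      using u'(2)[OF p, of h] linear_add[OF lin[OF p], of "(h, 0)" "(0, u' p h)"] by simp
    moreover have "A p *v u' p h = F' (p, u p) (0, u' p h)"
      unfolding A_def using matrix_works linL[OF p] by (metis linear_matrix_vector_mul_eq)
    ultimately have "A p *v u' p h = - F' (p, u p) (h, 0)"
      by (simp add: eq_neg_iff_add_eq_0 add.commute)
    then show ?thesis
      using cramer[OF det[OF p], of "u' p h" "- F' (p, u p) (h, 0)"] by (simp add: c_def cong: if_cong)
  qed
  show "Dk n P u"
  proof (induction n)
    case 0
    then show ?case using u by simp
  next
    case (Suc n)
    have pair: "Dk n P (\<lambda>p. (p, u p))" by (intro Dk_Pair Dk_id Suc)
    have part: "Dk n P (\<lambda>p. F' (p, u p) b)" if "b \<in> Basis" for b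
      by (rule Dk_compose[OF pair Dk_partial[OF \<open>open W\<close> F F' that] W])
    have A: "Dk n P (\<lambda>p. A p $ i $ j)" for i j
    proof -
      have "(0, axis j 1) \<in> (Basis :: ('a \<times> (real^'n)) set)"
        by (auto simp: Basis_prod_def axis_in_Basis_iff)
      then show ?thesis unfolding A_def matrix_def by (simp add: Dk_vec_nth part)
    qed
    have "Dk n P (\<lambda>p. u' p b)" if b: "b \<in> Basis" for b
    proof (rule Dk_cong[OF \<open>open P\<close>])
      show "(\<chi> k. c p b k) = u' p b" if "p \<in> P" for p by (simp add: u'_eq[OF that])
      have "(b, 0) \<in> (Basis :: ('a \<times> (real^'n)) set)" using b by (auto simp: Basis_prod_def)
      then have rhs: "Dk n P (\<lambda>p. - F' (p, u p) (b, 0) $ i)" for i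
        using Dk_uminus[OF Dk_vec_nth[OF part]] by simp
      have "Dk n P (\<lambda>p. c p b k)" for k
        unfolding c_def
      proof (intro Dk_divide Dk_det A det)
        show "Dk n P (\<lambda>p. (\<chi> i j. if j = k then - F' (p, u p) (b, 0) $ i else A p $ i $ j) $ i $ j)" for i j
          using rhs[of i] A[of i j] by (cases "j = k") auto
      qed
      then show "Dk n P (\<lambda>p. \<chi> k. c p b k)" by (intro Dk_vec_lambda) simp
    qed
    then show ?case using u'(1) by auto
  qed
qed

section \<open>Length decreasing self-maps of a round sphere\<close>

(* For l < 1 the function t |-> arccos (l * (c 0 . c t)) has no singularities and is still k-Lipschitz. *)
lemma arccos_sphere_curve_le:
  fixes c :: "real \<Rightarrow> 'a::real_inner"
  assumes c: "\<And>t. (c has_vector_derivative c' t) (at t)"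
    and n: "\<And>t. norm (c t) = 1"
    and k: "\<And>t. 0 \<le> t \<Longrightarrow> t \<le> a \<Longrightarrow> norm (c' t) \<le> k"
    and a: "0 < a"
  shows "arccos (c 0 \<bullet> c a) \<le> k * a"
proof -
  have cc: "c t \<bullet> c t = 1" for t using n[of t] by (simp add: norm_eq_1)
  have orth: "c t \<bullet> c' t = 0" for t
  proof -
    have "((\<lambda>t. c t \<bullet> c t) has_vector_derivative c t \<bullet> c' t + c' t \<bullet> c t) (at t)"
      by (rule bounded_bilinear.has_vector_derivative[OF bounded_bilinear_inner c c])
    then have "((\<lambda>t::real. 1::real) has_vector_derivative c t \<bullet> c' t + c' t \<bullet> c t) (at t)"
      by (simp add: cc)
    then have "c t \<bullet> c' t + c' t \<bullet> c t = 0"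
      using vector_derivative_unique_at has_vector_derivative_const by blast
    then show ?thesis by (simp add: inner_commute)
  qed
  define s where "s t = c 0 \<bullet> c t" for t
  have s_le: "\<bar>s t\<bar> \<le> 1" for t
    using Cauchy_Schwarz_ineq2[of "c 0" "c t"] by (simp add: s_def n)
  have s': "(s has_real_derivative c 0 \<bullet> c' t) (at t)" for t
    unfolding s_def has_real_derivative_iff_has_vector_derivative
    using bounded_linear.has_vector_derivative[OF bounded_linear_inner_right c] by blast
  have bd: "\<bar>c 0 \<bullet> c' t\<bar> \<le> norm (c' t) * sqrt (1 - (s t)\<^sup>2)" for t
  proof -
    \<comment> \<open>The velocity is orthogonal to c t, so c 0 may be replaced by its component
      tangent at c t, whose length is the sine of the angle between c 0 and c t.\<close>
    have "c 0 \<bullet> c' t = (c 0 - s t *\<^sub>R c t) \<bullet> c' t" by (simp add: inner_diff_left orth)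
    moreover have "norm (c 0 - s t *\<^sub>R c t) = sqrt (1 - (s t)\<^sup>2)"
      unfolding norm_eq_sqrt_inner
      by (simp add: inner_diff_left inner_diff_right cc inner_commute s_def power2_eq_square)
    ultimately show ?thesis
      using Cauchy_Schwarz_ineq2[of "c 0 - s t *\<^sub>R c t" "c' t"] by (simp add: mult.commute)
  qed
  have l: "arccos (l * s a) \<le> arccos l + k * a" if l: "0 < l" "l < 1" for l
  proof -
    define f where "f t = arccos (l * s t)" for t
    have lt: "\<bar>l * s t\<bar> < 1" for t
      using l mult_left_mono[OF s_le[of t], of l] unfolding abs_mult by linarith
    define f' where "f' t = inverse (- sqrt (1 - (l * s t)\<^sup>2)) * (l * (c 0 \<bullet> c' t))" for t
    have "(f has_real_derivative f' t) (at t)" for t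
      unfolding f_def f'_def
    proof (rule DERIV_chain2[OF DERIV_arccos])
      show "- 1 < l * s t" "l * s t < 1" using lt[of t] by linarith+
      show "((\<lambda>t. l * s t) has_real_derivative l * (c 0 \<bullet> c' t)) (at t)"
        by (rule DERIV_cmult[OF s'])
    qed
    then obtain z where z: "0 < z" "z < a" "f a - f 0 = (a - 0) * f' z"
      using MVT2[of 0 a f f'] a by blast
    have "f' z \<le> k"
    proof -
      have pos: "1 - (l * s z)\<^sup>2 > 0" using lt[of z] by (simp add: abs_square_less_1)
      have "l\<^sup>2 \<le> 1" using l by (simp add: power_le_one)
      \<comment> \<open>After squaring this is l^2 - l^2 s^2 \<le> 1 - l^2 s^2. It shows that
        scaling by l does not spoil the Lipschitz constant.\<close>
      then have "l * sqrt (1 - (s z)\<^sup>2) \<le> sqrt (1 - (l * s z)\<^sup>2)"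
        using l by (intro real_le_rsqrt) (simp add: power_mult_distrib algebra_simps s_le abs_square_le_1)
      then have "norm (c' z) * (l * sqrt (1 - (s z)\<^sup>2)) \<le> norm (c' z) * sqrt (1 - (l * s z)\<^sup>2)"
        by (intro mult_left_mono) auto
      moreover have "l * \<bar>c 0 \<bullet> c' z\<bar> \<le> l * (norm (c' z) * sqrt (1 - (s z)\<^sup>2))"
        using bd[of z] l by (intro mult_left_mono) auto
      ultimately have "l * \<bar>c 0 \<bullet> c' z\<bar> \<le> norm (c' z) * sqrt (1 - (l * s z)\<^sup>2)"
        by (simp add: mult_ac)
      then have "l * \<bar>c 0 \<bullet> c' z\<bar> / sqrt (1 - (l * s z)\<^sup>2) \<le> norm (c' z)"
        using pos by (simp add: pos_divide_le_eq)
      moreover have "f' z \<le> \<bar>f' z\<bar>" by simp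
      moreover have "\<bar>f' z\<bar> = l * \<bar>c 0 \<bullet> c' z\<bar> / sqrt (1 - (l * s z)\<^sup>2)"
        using l pos by (simp add: f'_def abs_mult divide_inverse)
      moreover have "norm (c' z) \<le> k" using k z by simp
      ultimately show ?thesis by (metis order_trans)
    qed
    then have "f a - f 0 \<le> a * k" using z a by simp
    moreover have "f 0 = arccos l" by (simp add: f_def s_def cc)
    ultimately show ?thesis by (simp add: f_def mult.commute)
  qed
  \<comment> \<open>Any sequence in the open interval (0,1) with limit 1 would serve; the shift by 2
    keeps \<open>L 0\<close> positive.\<close>
  define L where "L m = 1 - 1 / real (m + 2)" for m
  have L01: "0 < L m" "L m < 1" for m by (auto simp: L_def field_simps)
  have "(\<lambda>m. 1 / real (m + 2)) \<longlonglongrightarrow> 0" by (rule LIMSEQ_ignore_initial_segment[OF lim_1_over_n])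
  then have Llim: "L \<longlonglongrightarrow> 1" unfolding L_def using tendsto_diff[OF tendsto_const] by fastforce
  have "(\<lambda>m. arccos (L m * s a)) \<longlonglongrightarrow> arccos (1 * s a)"
  proof (rule continuous_on_tendsto_compose[OF continuous_on_arccos'])
    show "(\<lambda>m. L m * s a) \<longlonglongrightarrow> 1 * s a" by (intro tendsto_mult Llim tendsto_const)
    show "1 * s a \<in> {-1..1}" using s_le[of a] by auto
    have "\<bar>L m * s a\<bar> \<le> 1" for m
      using L01[of m] s_le[of a] mult_mono[of "L m" 1 "\<bar>s a\<bar>" 1] by (simp add: abs_mult)
    then show "eventually (\<lambda>m. L m * s a \<in> {-1..1}) sequentially"
      by (auto simp: abs_le_iff intro!: always_eventually)
  qed
  moreover have "(\<lambda>m. arccos (L m) + k * a) \<longlonglongrightarrow> arccos 1 + k * a"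
  proof (intro tendsto_add tendsto_const continuous_on_tendsto_compose[OF continuous_on_arccos' Llim])
    show "eventually (\<lambda>m. L m \<in> {-1..1}) sequentially"
      using L01 by (auto intro!: always_eventually simp: less_imp_le) (smt (verit))
  qed auto
  moreover have "\<forall>m\<ge>0. arccos (L m * s a) \<le> arccos (L m) + k * a" using l L01 by auto
  ultimately have "arccos (1 * s a) \<le> arccos 1 + k * a"
    by (intro LIMSEQ_le) blast+
  then show ?thesis by (simp add: s_def)
qed

lemma sphere_geodesic:
  fixes x y :: "'a::euclidean_space"
  assumes "norm x = 1" "norm y = 1" "x \<noteq> y" "2 \<le> DIM('a)"
  obtains w where "norm w = 1" "x \<bullet> w = 0"
    "y = cos (arccos (x \<bullet> y)) *\<^sub>R x + sin (arccos (x \<bullet> y)) *\<^sub>R w" "0 < arccos (x \<bullet> y)"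
proof -
  have xx: "x \<bullet> x = 1" "y \<bullet> y = 1" using assms by (auto simp: norm_eq_1)
  define s where "s = x \<bullet> y"
  have s: "\<bar>s\<bar> \<le> 1" using Cauchy_Schwarz_ineq2[of x y] assms by (simp add: s_def)
  have yn: "(y - s *\<^sub>R x) \<bullet> (y - s *\<^sub>R x) = 1 - s\<^sup>2"
    by (simp add: inner_diff_left inner_diff_right xx s_def inner_commute power2_eq_square)
  have "s \<noteq> 1"
  proof
    assume "s = 1"
    then have "y - x = 0" using yn by simp
    then show False using assms by simp
  qed
  then have pos: "0 < arccos s" using arccos_less_arccos[of s 1] s by auto
  have cs: "cos (arccos s) = s" "sin (arccos s) = sqrt (1 - s\<^sup>2)"
    using s by (auto simp: cos_arccos_abs sin_arccos_abs)
  show thesis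
  proof (cases "s = -1")
    \<comment> \<open>For antipodal points the component of y orthogonal to x vanishes and singles
      out no direction, but the sine vanishes as well. Any unit vector orthogonal to x works, and
      one exists because the dimension is at least 2.\<close>
    case True
    obtain w where w: "w \<noteq> 0" "orthogonal x w"
      using orthogonal_to_vector_exists[OF assms(4)] by blast
    have "(y - s *\<^sub>R x) = 0" using yn True by (metis inner_eq_zero_iff power2_minus one_power2 diff_self)
    then show thesis
      using w True cs pos by (intro that[of "w /\<^sub>R norm w"]) (auto simp: orthogonal_def s_def)
  next
    case False
    then have "s\<^sup>2 < 1" using s \<open>s \<noteq> 1\<close> by (simp add: abs_square_less_1)
    then have p: "sqrt (1 - s\<^sup>2) > 0" by simp
    have "norm (y - s *\<^sub>R x) = sqrt (1 - s\<^sup>2)" using yn by (simp add: norm_eq_sqrt_inner)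
    then show thesis
      using p cs pos
      by (intro that[of "(y - s *\<^sub>R x) /\<^sub>R sqrt (1 - s\<^sup>2)"])
         (auto simp: s_def[symmetric] inner_diff_right xx)
  qed
qed

text \<open>The image under h of the great circle arc from x to y has speed below 1 at every time.
  Compactness of the parameter interval makes the maximal speed itself less than 1, so the image
  curve is strictly shorter than the arc.\<close>

lemma length_decreasing_arccos_less:
  fixes h :: "'a::euclidean_space \<Rightarrow> 'a"
  assumes h: "\<And>x. norm x = 1 \<Longrightarrow> norm (h x) = 1"
    and h': "\<And>x. norm x = 1 \<Longrightarrow> (h has_derivative h' x) (at x)"
    and cont: "\<And>w. continuous_on (sphere 0 1) (\<lambda>x. h' x w)"
    and decr: "\<And>x w. norm x = 1 \<Longrightarrow> x \<bullet> w = 0 \<Longrightarrow> w \<noteq> 0 \<Longrightarrow> norm (h' x w) < norm w"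
    and xy: "norm x = 1" "norm y = 1" "x \<noteq> y" and dim: "2 \<le> DIM('a)"
  shows "arccos (h x \<bullet> h y) < arccos (x \<bullet> y)"
proof -
  define a where "a = arccos (x \<bullet> y)"
  obtain w where w: "norm w = 1" "x \<bullet> w = 0" "y = cos a *\<^sub>R x + sin a *\<^sub>R w" "0 < a"
    using sphere_geodesic[OF xy dim] unfolding a_def by blast
  have ww: "w \<bullet> w = 1" "x \<bullet> x = 1" using w xy by (auto simp: norm_eq_1)
  define \<gamma> \<gamma>' where "\<gamma> t = cos t *\<^sub>R x + sin t *\<^sub>R w" and "\<gamma>' t = - sin t *\<^sub>R x + cos t *\<^sub>R w" for t
  have \<gamma>: "norm (\<gamma> t) = 1" "norm (\<gamma>' t) = 1" "\<gamma> t \<bullet> \<gamma>' t = 0" for t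
    unfolding norm_eq_1 \<gamma>_def \<gamma>'_def
    by (simp_all add: inner_add_left inner_add_right inner_diff_left inner_diff_right ww w(2)
        inner_commute[of w x] flip: power2_eq_square)
  have d: "(\<gamma> has_vector_derivative \<gamma>' t) (at t)" for t
    unfolding \<gamma>_def \<gamma>'_def by (auto intro!: derivative_eq_intros)
  define c' where "c' t = h' (\<gamma> t) (\<gamma>' t)" for t
  have c: "((\<lambda>t. h (\<gamma> t)) has_vector_derivative c' t) (at t)" for t
  proof -
    have "((\<lambda>t. h (\<gamma> t)) has_derivative (\<lambda>s. h' (\<gamma> t) (s *\<^sub>R \<gamma>' t))) (at t)"
      using has_derivative_compose[OF d[unfolded has_vector_derivative_def] h'[OF \<gamma>(1)]] .
    then show ?thesis
      using has_derivative_linear[OF h'[OF \<gamma>(1)]]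
      by (simp add: has_vector_derivative_def c'_def linear_scale)
  qed
  \<comment> \<open>Continuity of the derivative is available only for a fixed argument vector,
    hence the expansion in the constant vectors x and w.\<close>
  have "c' = (\<lambda>t. - sin t *\<^sub>R h' (\<gamma> t) x + cos t *\<^sub>R h' (\<gamma> t) w)"
    using has_derivative_linear[OF h'[OF \<gamma>(1)]]
    by (auto simp: c'_def \<gamma>'_def linear_add linear_scale linear_neg linear_diff)
  moreover have "continuous_on UNIV (\<lambda>t. h' (\<gamma> t) v)" for v
    using \<gamma>(1) by (intro continuous_on_compose2[OF cont[of v]])
      (auto simp: \<gamma>_def intro!: continuous_intros)
  ultimately have "continuous_on {0..a} (\<lambda>t. norm (c' t))"
    by (auto intro!: continuous_intros intro: continuous_on_subset)
  then obtain m where m: "m \<in> {0..a}" "\<And>t. t \<in> {0..a} \<Longrightarrow> norm (c' t) \<le> norm (c' m)"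
    using continuous_attains_sup[of "{0..a}" "\<lambda>t. norm (c' t)"] w(4) by auto
  have "norm (c' m) < 1"
    using decr[OF \<gamma>(1) \<gamma>(3), of m] \<gamma>(2)[of m] by (force simp: c'_def)
  then have "norm (c' m) * a < a" using w(4) by simp
  moreover have "arccos (h (\<gamma> 0) \<bullet> h (\<gamma> a)) \<le> norm (c' m) * a"
    using arccos_sphere_curve_le[OF c, of a "norm (c' m)"] h \<gamma>(1) m w(4) by auto
  moreover have "\<gamma> 0 = x" "\<gamma> a = y" using w(3) by (auto simp: \<gamma>_def)
  ultimately show ?thesis by (simp add: a_def)
qed

text \<open>Edelstein's argument: the displacement \<open>arccos (x \<bullet> h x)\<close> attains a
  minimum on the compact sphere. If the minimiser x were not fixed, the point h x would have a
  strictly smaller displacement. Two distinct fixed points would contradict the strict decrease of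
  their distance.\<close>

lemma length_decreasing_unique_fixpoint:
  fixes h :: "'a::euclidean_space \<Rightarrow> 'a"
  assumes h: "\<And>x. norm x = 1 \<Longrightarrow> norm (h x) = 1"
    and h': "\<And>x. norm x = 1 \<Longrightarrow> (h has_derivative h' x) (at x)"
    and cont: "\<And>w. continuous_on (sphere 0 1) (\<lambda>x. h' x w)"
    and decr: "\<And>x w. norm x = 1 \<Longrightarrow> x \<bullet> w = 0 \<Longrightarrow> w \<noteq> 0 \<Longrightarrow> norm (h' x w) < norm w"
    and dim: "2 \<le> DIM('a)"
  shows "\<exists>!x. norm x = 1 \<and> h x = x"
proof -
  have less: "arccos (h x \<bullet> h y) < arccos (x \<bullet> y)" if "norm x = 1" "norm y = 1" "x \<noteq> y" for x y
    using length_decreasing_arccos_less[where h = h and h' = h'] h h' cont decr that dim by blast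
  have hc: "continuous_on (sphere 0 1) h"
    using has_derivative_continuous[OF h'] by (intro continuous_at_imp_continuous_on) auto
  have "continuous_on (sphere 0 1) (\<lambda>x. arccos (x \<bullet> h x))"
  proof (rule continuous_on_compose2[OF continuous_on_arccos'])
    show "continuous_on (sphere 0 1) (\<lambda>x. x \<bullet> h x)" by (intro continuous_intros hc)
    have "\<bar>x \<bullet> h x\<bar> \<le> 1" if "norm x = 1" for x
      using Cauchy_Schwarz_ineq2[of x "h x"] h that by simp
    then show "(\<lambda>x. x \<bullet> h x) ` sphere 0 1 \<subseteq> {- 1..1}" by (force simp: abs_le_iff)
  qed
  moreover have "sphere (0::'a) 1 \<noteq> {}" by simp
  ultimately obtain x where "x \<in> sphere 0 1" "\<forall>y\<in>sphere 0 1. arccos (x \<bullet> h x) \<le> arccos (y \<bullet> h y)"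
    using continuous_attains_inf[OF compact_sphere] by blast
  then have x: "norm x = 1" "\<And>y. norm y = 1 \<Longrightarrow> arccos (x \<bullet> h x) \<le> arccos (y \<bullet> h y)"
    by simp_all
  have "h x = x"
  proof (rule ccontr)
    assume "h x \<noteq> x"
    then have "arccos (h x \<bullet> h (h x)) < arccos (x \<bullet> h x)" 
      using less[OF x(1) h[OF x(1)]] by simp
    then show False using x(2)[OF h[OF x(1)]] by simp
  qed
  moreover have "y = z" if "norm y = 1" "h y = y" "norm z = 1" "h z = z" for y z
    using less[OF that(1,3)] that(2,4) by auto
  ultimately show ?thesis using x(1) by blast
qed

text \<open>Instead of normalising, which would need a square root, a neighbourhood of the unit sphere is
  mapped by the polynomial r x = ((3 - x \<bullet> x) / 2) x: it fixes the sphere pointwise and its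
  derivative there is the orthogonal projection to the tangent space.\<close>

lemma smooth_fixpoint_family:
  fixes Q :: "'p::euclidean_space \<Rightarrow> real^'n \<Rightarrow> real^'n" and f :: "real^'n \<Rightarrow> real^'n"
  assumes dim: "2 \<le> CARD('n)"
    and Q_lin: "\<And>p. linear (Q p)" and Q_norm: "\<And>p y. norm (Q p y) = (norm p)\<^sup>2 * norm y"
    and Q_Dk: "\<And>n. Dk n UNIV (\<lambda>z. Q (fst z) (snd z))"
    and V: "open V" "sphere 0 1 \<subseteq> V" and f: "\<And>n. Dk n V f"
    and f_sphere: "\<And>x. norm x = 1 \<Longrightarrow> norm (f x) = 1"
    and f': "\<And>x. x \<in> V \<Longrightarrow> (f has_derivative f' x) (at x)"
    and decr: "\<And>x w. norm x = 1 \<Longrightarrow> x \<bullet> w = 0 \<Longrightarrow> w \<noteq> 0 \<Longrightarrow> norm (f' x w) < norm w"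
  shows "\<exists>u. (\<forall>p. p \<noteq> 0 \<longrightarrow> (\<forall>x. norm x = 1 \<and> Q p (f x) = (norm p)\<^sup>2 *\<^sub>R x \<longleftrightarrow> x = u p))
    \<and> (\<forall>n. Dk n (-{0}) u)"
proof -
  have dim': "2 \<le> DIM(real^'n)" using dim by simp
  have blQ: "bounded_linear (Q p)" for p using Q_lin by (simp add: linear_conv_bounded_linear)
  have f'_cont: "continuous_on (sphere 0 1) (\<lambda>x. f' x w)" for w
  proof -
    have "continuous_on (sphere 0 1) (\<lambda>x. \<Sum>b\<in>Basis. (w \<bullet> b) *\<^sub>R f' x b)"
    proof (intro continuous_intros)
      show "continuous_on (sphere 0 1) (\<lambda>x. f' x b)" if "b \<in> Basis" for b
        using Dk_imp_continuous_on[OF Dk_partial[OF V(1) f f' that]] V(2) continuous_on_subset by blast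
    qed
    moreover have "(\<Sum>b\<in>Basis. (w \<bullet> b) *\<^sub>R f' x b) = f' x w" if "x \<in> sphere 0 1" for x
    proof -
      have "linear (f' x)" using f' V(2) that has_derivative_linear by blast
      then have "(\<Sum>b\<in>Basis. (w \<bullet> b) *\<^sub>R f' x b) = f' x (\<Sum>b\<in>Basis. (w \<bullet> b) *\<^sub>R b)"
        by (simp add: linear_sum linear_scale)
      then show ?thesis by (simp add: euclidean_representation)
    qed
    ultimately show ?thesis by (rule continuous_on_eq)
  qed
  \<comment> \<open>Dividing by \<open>(norm p)\<^sup>2\<close> turns \<open>Q p\<close> into a
    linear isometry, so its composition with f is again strictly length decreasing.\<close>
  have ex1: "\<exists>!x. norm x = 1 \<and> Q p (f x) /\<^sub>R (norm p)\<^sup>2 = x" if p: "p \<noteq> 0" for p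
  proof (rule length_decreasing_unique_fixpoint[OF _ _ _ _ dim'])
    show "norm (Q p (f x) /\<^sub>R (norm p)\<^sup>2) = 1" if "norm x = 1" for x
      using p f_sphere[OF that] by (simp add: Q_norm)
    show "((\<lambda>x. Q p (f x) /\<^sub>R (norm p)\<^sup>2) has_derivative (\<lambda>w. Q p (f' x w) /\<^sub>R (norm p)\<^sup>2)) (at x)"
      if "norm x = 1" for x
      using V(2) that
      by (intro has_derivative_scaleR_right bounded_linear.has_derivative[OF blQ] f') auto
    show "continuous_on (sphere 0 1) (\<lambda>x. Q p (f' x w) /\<^sub>R (norm p)\<^sup>2)" for w
      by (intro continuous_intros bounded_linear.continuous_on[OF blQ] f'_cont)
    show "norm (Q p (f' x w) /\<^sub>R (norm p)\<^sup>2) < norm w" if "norm x = 1" "x \<bullet> w = 0" "w \<noteq> 0" for x w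
      using p decr[OF that] by (simp add: Q_norm flip: mult.assoc)
  qed
  have eq_iff: "Q p (f x) /\<^sub>R (norm p)\<^sup>2 = x \<longleftrightarrow> Q p (f x) = (norm p)\<^sup>2 *\<^sub>R x" if "p \<noteq> 0" for p x
  proof -
    have "(norm p)\<^sup>2 \<noteq> 0" using that by simp
    from divideR_right[OF this, of x "Q p (f x)"] show ?thesis by metis
  qed
  define u where "u p = (THE x. norm x = 1 \<and> Q p (f x) /\<^sub>R (norm p)\<^sup>2 = x)" for p
  have u: "norm (u p) = 1" "Q p (f (u p)) /\<^sub>R (norm p)\<^sup>2 = u p" if "p \<noteq> 0" for p
    using theI'[OF ex1[OF that]] unfolding u_def by blast+
  have u_iff: "norm x = 1 \<and> Q p (f x) /\<^sub>R (norm p)\<^sup>2 = x \<longleftrightarrow> x = u p" if "p \<noteq> 0" for p x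
    using ex1[OF that] u[OF that] by blast
  have Q_cont: "continuous_on UNIV (\<lambda>z. Q (fst z) (snd z))"
    using Dk_imp_continuous_on[OF Q_Dk] .
  \<comment> \<open>A map into a compact space is continuous once its graph is closed. Uniqueness of
    the fixed point makes the graph the full zero set of a continuous function.\<close>
  have u_cont: "continuous_on (-{0}) u"
  proof -
    have g: "(\<lambda>p. (p, u p)) ` (-{0}) = (-{0}) \<times> sphere 0 1 \<inter>
        (\<lambda>z. Q (fst z) (f (snd z)) /\<^sub>R (norm (fst z))\<^sup>2 - snd z) -` {0}"
    proof (rule set_eqI)
      fix z :: "'p \<times> (real^'n)"
      obtain p x where z: "z = (p, x)" by (cases z)
      show "z \<in> (\<lambda>p. (p, u p)) ` (-{0}) \<longleftrightarrow> z \<in> (-{0}) \<times> sphere 0 1 \<inter>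
          (\<lambda>z. Q (fst z) (f (snd z)) /\<^sub>R (norm (fst z))\<^sup>2 - snd z) -` {0}"
        using u_iff[of p x] unfolding z by (cases "p = 0") (simp_all add: image_iff)
    qed
    have "continuous_on ((-{0}) \<times> sphere 0 1) (\<lambda>z. f (snd z))"
      using V(2) by (intro continuous_on_compose2[OF Dk_imp_continuous_on[OF f]] continuous_intros) auto
    then have "continuous_on ((-{0::'p}) \<times> sphere 0 1) (\<lambda>z. Q (fst (fst z, f (snd z))) (snd (fst z, f (snd z))))"
      by (intro continuous_on_compose2[OF Q_cont] continuous_intros) auto
    then have "continuous_on ((-{0}) \<times> sphere 0 1)
        (\<lambda>z. Q (fst z) (f (snd z)) /\<^sub>R (norm (fst z))\<^sup>2 - snd z)"
      by (intro continuous_intros) auto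
    then have "closedin (top_of_set ((-{0}) \<times> sphere 0 1)) ((\<lambda>p. (p, u p)) ` (-{0}))"
      unfolding g by (rule continuous_closedin_preimage) simp
    then show ?thesis
      using continuous_closed_graph_eq[of "sphere 0 1" u "-{0}"] u(1) by auto
  qed
  define r :: "real^'n \<Rightarrow> real^'n" where "r x = ((3 - x \<bullet> x) / 2) *\<^sub>R x" for x
  have r_sphere: "r x = x" if "norm x = 1" for x using that by (simp add: r_def norm_eq_1)
  have r_Dk: "Dk n U r" for n U
    unfolding r_def divide_inverse by (intro Dk_scaleR Dk_mult Dk_diff Dk_inner Dk_const Dk_id)
  define r' where "r' x w = w - (x \<bullet> w) *\<^sub>R x" for x w :: "real^'n"
  have r': "(r has_derivative r' x) (at x)" if "norm x = 1" for x
    using that unfolding r_def r'_def norm_eq_1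
    by (auto intro!: derivative_eq_intros simp: inner_commute algebra_simps)
  define W where "W = (-{0::'p}) \<times> (r -` V)"
  have "continuous_on UNIV r" using Dk_imp_continuous_on[OF r_Dk] .
  then have W: "open W" using V(1) by (auto simp: W_def intro!: open_Times open_vimage)
  \<comment> \<open>The length bound on f' covers tangential directions only. Composing f with r
    removes the normal direction from the first term, where the x-derivative of F is then minus the
    identity.\<close>
  define F where "F z = Q (fst z) (f (r (snd z))) /\<^sub>R (norm (fst z))\<^sup>2 - snd z" for z
  have fst_snd: "Dk n W fst" "Dk n W snd" for n
    using Dk_linear[OF bounded_linear_fst Dk_id] Dk_linear[OF bounded_linear_snd Dk_id] by auto
  have "Dk n W (\<lambda>z. (fst z, f (r (snd z))))" for n
    by (intro Dk_Pair fst_snd Dk_compose[OF Dk_compose[OF fst_snd(2) r_Dk] f]) (auto simp: W_def)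
  from Dk_compose[OF this Q_Dk]
  have QW: "Dk n W (\<lambda>z. Q (fst z) (f (r (snd z))))" for n by simp
  have F_Dk: "Dk n W F" for n
    unfolding F_def power2_norm_eq_inner
    by (intro Dk_diff Dk_scaleR Dk_inverse Dk_inner fst_snd QW) (auto simp: W_def)
  obtain F' where F': "\<And>z. z \<in> W \<Longrightarrow> (F has_derivative F' z) (at z)"
    using F_Dk[of "Suc 0"] by auto
  have uW: "(p, u p) \<in> W" if "p \<in> -{0}" for p
    using u(1)[of p] V(2) that by (auto simp: W_def r_sphere)
  have "Dk n (-{0}) u" for n
  proof (rule implicit_Dk[OF _ W F_Dk F' u_cont uW])
    fix p :: 'p assume p: "p \<in> -{0}"
    then show "F (p, u p) = 0" using u[of p] by (simp add: F_def r_sphere)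
    have "((\<lambda>x. F (p, x)) has_derivative (\<lambda>k. F' (p, u p) (0, k))) (at (u p))"
      by (rule has_derivative_compose[of "\<lambda>x. (p, x)" "\<lambda>k. (0, k)", OF _ F'[OF uW[OF p]]])
        (auto intro!: derivative_eq_intros)
    moreover have "((\<lambda>x. F (p, x)) has_derivative
       (\<lambda>k. Q p (f' (u p) (r' (u p) k)) /\<^sub>R (norm p)\<^sup>2 - k)) (at (u p))"
    proof -
      have "((\<lambda>x. f (r x)) has_derivative (\<lambda>k. f' (r (u p)) (r' (u p) k))) (at (u p))"
        using u(1)[of p] p V(2) by (intro has_derivative_compose[OF r' f']) (auto simp: r_sphere)
      then have "((\<lambda>x. f (r x)) has_derivative (\<lambda>k. f' (u p) (r' (u p) k))) (at (u p))"
        using u(1)[of p] p by (simp add: r_sphere)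
      then show ?thesis
        unfolding F_def fst_conv snd_conv
        by (intro has_derivative_diff has_derivative_scaleR_right bounded_linear.has_derivative[OF blQ]
            has_derivative_ident)
    qed
    ultimately have F'_eq: "(\<lambda>k. F' (p, u p) (0, k)) = (\<lambda>k. Q p (f' (u p) (r' (u p) k)) /\<^sub>R (norm p)\<^sup>2 - k)"
      by (rule has_derivative_unique)
    have lin: "linear (\<lambda>k. F' (p, u p) (0, k))"
      using \<open>((\<lambda>x. F (p, x)) has_derivative (\<lambda>k. F' (p, u p) (0, k))) (at (u p))\<close> has_derivative_linear by blast
    \<comment> \<open>A nonzero kernel vector would satisfy |k| = |f' (r' k)| < |r' k| \<le> |k|:
      the outer map is an isometry, the tangential length bound is strict, and r' is an orthogonal
      projection.\<close>
    have "k = 0" if "F' (p, u p) (0, k) = 0" for k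
    proof (rule ccontr)
      assume "k \<noteq> 0"
      have nu: "norm (u p) = 1" using u p by auto
      have k: "k = Q p (f' (u p) (r' (u p) k)) /\<^sub>R (norm p)\<^sup>2" using that fun_cong[OF F'_eq, of k] by simp
      have "norm (Q p v /\<^sub>R (norm p)\<^sup>2) = norm v" for v
        using p by (simp add: Q_norm flip: mult.assoc)
      from this[of "f' (u p) (r' (u p) k)"] have nk: "norm k = norm (f' (u p) (r' (u p) k))"
        by (simp only: k[symmetric])
      have orth: "u p \<bullet> r' (u p) k = 0"
        using nu by (simp add: r'_def inner_diff_right norm_eq_1)
      have "(norm k)\<^sup>2 = (norm (r' (u p) k))\<^sup>2 + (u p \<bullet> k)\<^sup>2"
        using nu unfolding power2_norm_eq_inner r'_def
        by (simp add: inner_diff_left inner_diff_right norm_eq_1 inner_commute power2_eq_square)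
      then have "(norm (r' (u p) k))\<^sup>2 \<le> (norm k)\<^sup>2" by simp
      then have le: "norm (r' (u p) k) \<le> norm k" by (rule power2_le_imp_le) simp
      have "r' (u p) k \<noteq> 0"
      proof
        assume "r' (u p) k = 0"
        moreover have "linear (f' (u p))" using f' V(2) nu has_derivative_linear by (metis mem_sphere_0 subset_eq)
        ultimately show False using nk \<open>k \<noteq> 0\<close> by (simp add: linear_0)
      qed
      then show False using decr[OF nu orth] nk le by simp
    qed
    then show "inj (\<lambda>k. F' (p, u p) (0, k))"
      using lin linear_injective_0 by blast
  qed auto
  then show ?thesis using u_iff eq_iff by (intro exI[of _ u]) simp
qed

section \<open>Coordinates on the self-dual and anti-self-dual 2-vectors\<close>

definition vec4 :: "'a \<Rightarrow> 'a \<Rightarrow> 'a \<Rightarrow> 'a \<Rightarrow> 'a^4" where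
  "vec4 a b c d = (\<chi> i. if i = 1 then a else if i = 2 then b else if i = 3 then c else d)"

lemma vec4_nth [simp]:
  "vec4 a b c d $ 1 = a" "vec4 a b c d $ 2 = b" "vec4 a b c d $ 3 = c" "vec4 a b c d $ 4 = d"
  by (auto simp: vec4_def)

(* The unit sphere of real^3 corresponds to the spheres of radius 1 / sqrt 2 of the paper. *)
definition im :: "real^3 \<Rightarrow> real^4^4" where
  "im v = (1/2) *\<^sub>R vec4 (vec4 0 (v$1) (v$2) (v$3)) (vec4 (- v$1) 0 (- v$3) (v$2))
                     (vec4 (- v$2) (v$3) 0 (- v$1)) (vec4 (- v$3) (- v$2) (v$1) 0)"

text \<open>With R^4 read as the quaternions and v as an imaginary quaternion, \<open>ip v\<close>
  is left multiplication by -v/2, and \<open>im v\<close> is right multiplication by -v/2. This is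
  the source of all the identities relating them.\<close>

definition ip :: "real^3 \<Rightarrow> real^4^4" where
  "ip v = (1/2) *\<^sub>R vec4 (vec4 0 (v$1) (v$2) (v$3)) (vec4 (- v$1) 0 (v$3) (- v$2))
                     (vec4 (- v$2) (- v$3) 0 (v$1)) (vec4 (- v$3) (v$2) (- v$1) 0)"

text \<open>The antisymmetrised entries make \<open>cm\<close> and \<open>cp\<close> linear on all
  matrices: they are the coordinates of the orthogonal projections to the two eigenspaces of the
  Hodge star and vanish on symmetric matrices.\<close>

definition cm :: "real^4^4 \<Rightarrow> real^3" where
  "cm A = (1/2) *\<^sub>R vector [A$1$2 - A$2$1 - A$3$4 + A$4$3, A$1$3 - A$3$1 + A$2$4 - A$4$2,
                         A$1$4 - A$4$1 - A$2$3 + A$3$2]"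

definition cp :: "real^4^4 \<Rightarrow> real^3" where
  "cp A = (1/2) *\<^sub>R vector [A$1$2 - A$2$1 + A$3$4 - A$4$3, A$1$3 - A$3$1 - A$2$4 + A$4$2,
                         A$1$4 - A$4$1 + A$2$3 - A$3$2]"

lemmas coords = vec_eq_iff forall_4 forall_3 sum_4 sum_3 im_def ip_def cm_def cp_def vector_3
  wedge_def inner_vec_def matrix_vector_mult_def

lemma eps_nth: "eps i $ j = (if j = i then 1 else 0)"
  by (simp add: eps_def axis_def)

lemma bounded_linear_im: "bounded_linear im"
  unfolding linear_conv_bounded_linear[symmetric]
  by (rule linearI) (simp_all add: coords algebra_simps)

lemma bounded_linear_ip: "bounded_linear ip"
  unfolding linear_conv_bounded_linear[symmetric]
  by (rule linearI) (simp_all add: coords algebra_simps)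

lemma bounded_linear_cm: "bounded_linear cm"
  unfolding linear_conv_bounded_linear[symmetric]
  by (rule linearI) (simp_all add: coords algebra_simps)

lemma bounded_linear_cp: "bounded_linear cp"
  unfolding linear_conv_bounded_linear[symmetric]
  by (rule linearI) (simp_all add: coords algebra_simps)

lemma bounded_bilinear_wedge: "bounded_bilinear wedge"
  unfolding bilinear_conv_bounded_bilinear[symmetric] bilinear_def
  by (auto intro!: linearI simp: wedge_def vec_eq_iff algebra_simps)

lemma bounded_bilinear_matrix_vector_mult: "bounded_bilinear ((*v) :: real^'n^'m \<Rightarrow> _)"
  unfolding bilinear_conv_bounded_bilinear[symmetric] bilinear_def
  by (auto intro!: linearI simp: matrix_vector_mult_def vec_eq_iff algebra_simps sum.distrib sum_distrib_left)

lemma cm_im [simp]: "cm (im v) = v" and cp_ip [simp]: "cp (ip v) = v"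
  and cm_ip [simp]: "cm (ip v) = 0" and cp_im [simp]: "cp (im v) = 0"
  by (simp_all add: coords)

lemma Lambda2_iff: "A \<in> Lambda2 \<longleftrightarrow> (\<forall>i j. A$i$j = - A$j$i)"
  by (auto simp: Lambda2_def vec_eq_iff transpose_def)

lemma Lambda2_nth:
  assumes "A \<in> Lambda2"
  shows "A$1$1 = 0" "A$2$2 = 0" "A$3$3 = 0" "A$4$4 = 0" "A$2$1 = - A$1$2" "A$3$1 = - A$1$3"
    "A$4$1 = - A$1$4" "A$3$2 = - A$2$3" "A$4$2 = - A$2$4" "A$4$3 = - A$3$4"
  using assms[unfolded Lambda2_iff] by (metis neg_equal_zero)+

lemma Lambda2_decompose: "A \<in> Lambda2 \<Longrightarrow> im (cm A) + ip (cp A) = A"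
  by (simp add: coords Lambda2_nth) (simp add: field_simps)

lemma im_Lambda2: "im v \<in> Lambda2" and ip_Lambda2: "ip v \<in> Lambda2"
  by (auto simp: Lambda2_iff forall_4 im_def ip_def)

lemma wedge_Lambda2: "wedge v w \<in> Lambda2"
  by (auto simp: Lambda2_iff wedge_def)

lemma hodge_nth:
  "hodge A $ 1 = vec4 0 (A$3$4) (- A$2$4) (A$2$3)" "hodge A $ 2 = vec4 (- A$3$4) 0 (A$1$4) (- A$1$3)"
  "hodge A $ 3 = vec4 (A$2$4) (- A$1$4) 0 (A$1$2)" "hodge A $ 4 = vec4 (- A$2$3) (A$1$3) (- A$1$2) 0"
  by (simp_all add: hodge_def wedge_def eps_nth vec_eq_iff forall_4)

lemma Eminus_eq: "Eminus = range im"
proof (intro set_eqI iffI)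
  fix A assume "A \<in> Eminus"
  then have A: "A \<in> Lambda2" "hodge A = - A" by (auto simp: Eminus_def)
  then have "hodge A $ 1 $ 2 = - A$1$2" "hodge A $ 1 $ 3 = - A$1$3" "hodge A $ 1 $ 4 = - A$1$4" by simp_all
  then have "A$3$4 = - A$1$2" "A$2$4 = A$1$3" "A$2$3 = - A$1$4"
    unfolding hodge_nth vec4_nth by linarith+
  then have "A = im (cm A)"
    using Lambda2_nth[OF A(1)] by (simp add: coords)
  then show "A \<in> range im" by blast
next
  fix A assume "A \<in> range im"
  then show "A \<in> Eminus"
    using im_Lambda2 by (auto simp: Eminus_def vec_eq_iff forall_4 hodge_nth im_def)
qed

lemma Eplus_eq: "Eplus = range ip"
proof (intro set_eqI iffI)
  fix A assume "A \<in> Eplus"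
  then have A: "A \<in> Lambda2" "hodge A = A" by (auto simp: Eplus_def)
  then have "hodge A $ 1 $ 2 = A$1$2" "hodge A $ 1 $ 3 = A$1$3" "hodge A $ 1 $ 4 = A$1$4" by simp_all
  then have "A$3$4 = A$1$2" "A$2$4 = - A$1$3" "A$2$3 = A$1$4"
    unfolding hodge_nth vec4_nth by linarith+
  then have "A = ip (cp A)"
    using Lambda2_nth[OF A(1)] by (simp add: coords)
  then show "A \<in> range ip" by blast
next
  fix A assume "A \<in> range ip"
  then show "A \<in> Eplus"
    using ip_Lambda2 by (auto simp: Eplus_def vec_eq_iff forall_4 hodge_nth ip_def)
qed

lemma bv_inner_im: "bv_inner (im v) (im w) = (v \<bullet> w) / 2"
  and bv_inner_ip: "bv_inner (ip v) (ip w) = (v \<bullet> w) / 2"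
  by (simp_all add: bv_inner_def coords field_simps)

lemma bv_norm_im: "bv_norm (im v) = norm v / sqrt 2" and bv_norm_ip: "bv_norm (ip v) = norm v / sqrt 2"
  by (simp_all add: bv_norm_def bv_inner_im bv_inner_ip real_sqrt_divide norm_eq_sqrt_inner)

lemma S2minus_eq: "S2minus = im ` sphere 0 1" and S2plus_eq: "S2plus = ip ` sphere 0 1"
  by (auto simp: S2minus_def S2plus_def Eminus_eq Eplus_eq bv_norm_im bv_norm_ip)

lemma tan_S2minus_eq: "tan_S2minus (im x) = im ` {w. x \<bullet> w = 0}"
  by (auto simp: tan_S2minus_def Eminus_eq bv_inner_im inner_commute)

text \<open>An orthogonal projection does not increase length; the factor \<open>sqrt 2\<close> is
  the scale of the coordinates. Allowing every matrix A makes the bound applicable to the derivative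
  of an ambient extension of g without first locating its values.\<close>

lemma norm_cp_le: "norm (cp A) \<le> sqrt 2 * bv_norm A"
proof -
  have sq: "(a + b + c + d)\<^sup>2 \<le> 4 * (a\<^sup>2 + b\<^sup>2 + c\<^sup>2 + d\<^sup>2)" for a b c d :: real
  proof -
    have "4 * (a\<^sup>2 + b\<^sup>2 + c\<^sup>2 + d\<^sup>2) - (a + b + c + d)\<^sup>2
        = (a - b)\<^sup>2 + (a - c)\<^sup>2 + (a - d)\<^sup>2 + (b - c)\<^sup>2 + (b - d)\<^sup>2 + (c - d)\<^sup>2"
      by (simp add: power2_eq_square algebra_simps)
    then show ?thesis by (smt (verit) zero_le_power2)
  qed
  have z: "0 \<le> (A$i$i)\<^sup>2" for i by simp
  have "cp A \<bullet> cp A \<le> (\<Sum>i\<in>UNIV. \<Sum>j\<in>UNIV. (A$i$j)\<^sup>2)"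
    using sq[of "A$1$2" "- A$2$1" "A$3$4" "- A$4$3"] sq[of "A$1$3" "- A$3$1" "- A$2$4" "A$4$2"]
      sq[of "A$1$4" "- A$4$1" "A$2$3" "- A$3$2"]
    by (simp add: cp_def inner_vec_def sum_3 vector_3 sum_4 flip: power2_eq_square) 
      (simp add: power_divide, use z[of 1] z[of 2] z[of 3] z[of 4] in linarith)
  then have "cp A \<bullet> cp A \<le> 2 * bv_inner A A"
    by (simp add: bv_inner_def power2_eq_square)
  then show ?thesis
    unfolding norm_eq_sqrt_inner bv_norm_def real_sqrt_mult[symmetric] by simp
qed

section \<open>Points, 2-vectors and planes\<close>

text \<open>Imaginary quaternions square to minus their squared length, the two halves contribute
  the factor 1/4, and left and right multiplications commute by associativity.\<close>

lemma im_im: "im v *v (im v *v p) = - ((v \<bullet> v) / 4) *\<^sub>R p"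
  and ip_ip: "ip v *v (ip v *v p) = - ((v \<bullet> v) / 4) *\<^sub>R p"
  and im_ip: "im v *v (ip w *v p) = ip w *v (im v *v p)"
  by (simp_all add: coords) (simp_all add: field_simps)

lemma inner_im: "(im v *v p) \<bullet> (im v *v q) = (v \<bullet> v) / 4 * (p \<bullet> q)"
  and inner_im_self: "(im v *v p) \<bullet> p = 0" and inner_ip_self: "(ip v *v p) \<bullet> p = 0"
  by (simp_all add: coords field_simps)

text \<open>For unit p and y the vector \<open>-2 *\<^sub>R (ip y *v p)\<close> is a unit tangent
  vector at p. Its wedge with p has self-dual part \<open>ip y\<close>, and \<open>rot p y\<close>
  reads off the anti-self-dual part. The formula is polynomial in p, quadratic for fixed y, hence
  defined and smooth for all p.\<close>

definition rot :: "real^4 \<Rightarrow> real^3 \<Rightarrow> real^3" where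
  "rot p y = cm (wedge p (-2 *\<^sub>R (ip y *v p)))"

lemma linear_rot: "linear (rot p)"
  by (rule linearI) (simp_all add: rot_def coords algebra_simps)

lemma rot_Dk: "Dk n UNIV (\<lambda>z. rot (fst z) (snd z))"
  unfolding rot_def
  by (intro Dk_linear[OF bounded_linear_cm] Dk_bilinear[OF bounded_bilinear_wedge] Dk_scaleR Dk_const
      Dk_bilinear[OF bounded_bilinear_matrix_vector_mult] Dk_linear[OF bounded_linear_ip]
      Dk_linear[OF bounded_linear_fst] Dk_linear[OF bounded_linear_snd] Dk_id)

lemma norm_rot: "norm (rot p y) = (norm p)\<^sup>2 * norm y"
proof -
  have "rot p y \<bullet> rot p y = (p \<bullet> p)\<^sup>2 * (y \<bullet> y)"
    by (simp add: rot_def coords power2_eq_square) (simp add: field_simps)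
  then show ?thesis by (simp add: norm_eq_sqrt_inner real_sqrt_mult)
qed

lemma im_rot: "im (rot p y) *v p = (p \<bullet> p) *\<^sub>R (ip y *v p)"
  by (simp add: rot_def coords) (simp add: field_simps)

text \<open>These recover x and y from their action on a single nonzero p. When
  \<open>im x *v p = ip y *v p\<close> both apply to the same wedge and determine it completely,
  which is \<open>wedge_eq\<close>.\<close>

lemma cm_wedge: "cm (wedge p (-2 *\<^sub>R (im x *v p))) = (p \<bullet> p) *\<^sub>R x"
  and cp_wedge: "cp (wedge p (-2 *\<^sub>R (ip y *v p))) = (p \<bullet> p) *\<^sub>R y"
  by (simp_all add: coords) (simp_all add: field_simps)

lemma im_eq_ip_iff:
  assumes "p \<noteq> 0"
  shows "im x *v p = ip y *v p \<longleftrightarrow> rot p y = (norm p)\<^sup>2 *\<^sub>R x"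
proof
  assume "im x *v p = ip y *v p"
  then show "rot p y = (norm p)\<^sup>2 *\<^sub>R x"
    using cm_wedge[of p x] by (simp add: rot_def power2_norm_eq_inner)
next
  assume "rot p y = (norm p)\<^sup>2 *\<^sub>R x"
  then have "(p \<bullet> p) *\<^sub>R (ip y *v p) = (p \<bullet> p) *\<^sub>R (im x *v p)"
    using im_rot[of p y]
    by (simp add: power2_norm_eq_inner linear_scale[OF bounded_linear.linear[OF bounded_linear_im]]
        scaleR_matrix_vector_assoc)
  then show "im x *v p = ip y *v p" using assms by simp
qed

lemma im_vector_eq_iff: "p \<noteq> 0 \<Longrightarrow> im x *v p = im y *v p \<longleftrightarrow> x = y"
  using cm_wedge[of p x] cm_wedge[of p y] by fastforce

lemma ip_vector_eq_iff: "p \<noteq> 0 \<Longrightarrow> ip x *v p = ip y *v p \<longleftrightarrow> x = y"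
  using cp_wedge[of p x] cp_wedge[of p y] by fastforce

lemma wedge_mult: "wedge v w *v q = (w \<bullet> q) *\<^sub>R v - (v \<bullet> q) *\<^sub>R w"
  by (simp add: coords field_simps)

lemma wedge_eq:
  assumes "p \<bullet> p = 1" "im x *v p = ip y *v p"
  shows "wedge p (-2 *\<^sub>R (im x *v p)) = im x + ip y"
  using Lambda2_decompose[OF wedge_Lambda2, of p "-2 *\<^sub>R (im x *v p)"] cm_wedge[of p x] cp_wedge[of p y] assms
  by simp

lemma orthonormal_tangent:
  assumes "p \<bullet> p = 1" "norm x = 1"
  shows "(-2 *\<^sub>R (im x *v p)) \<bullet> (-2 *\<^sub>R (im x *v p)) = 1" "p \<bullet> (-2 *\<^sub>R (im x *v p)) = 0"
  using assms inner_im[of x p p] inner_im_self[of x p] by (auto simp: inner_commute norm_eq_1)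

text \<open>The matrices \<open>im x\<close> and \<open>ip y\<close> commute and have the same
  square, so (im x - ip y)(im x + ip y) = 0: every vector in the range of the sum solves the
  equation. The sum is nonzero because its anti-self-dual part is.\<close>

lemma kernel_exists:
  assumes "norm x = 1" "norm y = 1"
  obtains p where "p \<bullet> p = 1" "im x *v p = ip y *v p"
proof -
  have "im x + ip y \<noteq> 0"
  proof
    assume "im x + ip y = 0"
    then have "cm (im x + ip y) = 0" by (simp add: linear_0[OF bounded_linear.linear[OF bounded_linear_cm]])
    then show False using assms by (simp add: linear_add[OF bounded_linear.linear[OF bounded_linear_cm]])
  qed
  then obtain q where q: "(im x + ip y) *v q \<noteq> 0"
    by (metis matrix_eq matrix_vector_mult_0)
  define p where "p = im x *v q + ip y *v q"
  have p: "p \<noteq> 0" using q by (simp add: p_def matrix_vector_mult_add_rdistrib)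
  have "im x *v p = ip y *v p"
    unfolding p_def matrix_vector_right_distrib im_im ip_ip im_ip using assms by (simp add: norm_eq_1)
  then show thesis
    using p by (intro that[of "p /\<^sub>R norm p"])
      (auto simp: matrix_vector_mult_scaleR power2_norm_eq_inner[symmetric] power2_eq_square)
qed

lemma span_orthonormal_iff:
  fixes v w q :: "'a::real_inner"
  assumes "v \<bullet> v = 1" "w \<bullet> w = 1" "v \<bullet> w = 0"
  shows "q \<in> span {v, w} \<longleftrightarrow> q = (v \<bullet> q) *\<^sub>R v + (w \<bullet> q) *\<^sub>R w"
proof
  assume "q \<in> span {v, w}"
  then obtain a b where "q = a *\<^sub>R v + b *\<^sub>R w"
    using span_breakdown_eq[of q v "{w}"] span_breakdown_eq[of _ w "{}"]
    by (auto simp: algebra_simps)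
  then show "q = (v \<bullet> q) *\<^sub>R v + (w \<bullet> q) *\<^sub>R w"
    using assms by (simp add: inner_add_right inner_commute)
next
  assume "q = (v \<bullet> q) *\<^sub>R v + (w \<bullet> q) *\<^sub>R w"
  then show "q \<in> span {v, w}"
    by (metis insertCI span_add span_base span_scale)
qed

text \<open>A unit simple 2-vector A acts as a quarter turn on its plane and as zero on the
  complement, so the plane is where A^2 = -1. For A = im x + ip y the square is -1/2 + 2 (im x)(ip
  y), and multiplying the resulting condition by \<open>im x\<close> makes it linear.\<close>

lemma span_eq_kernel:
  assumes v: "v1 \<bullet> v1 = 1" "v2 \<bullet> v2 = 1" "v1 \<bullet> v2 = 0" "wedge v1 v2 = im x + ip y"
    and xy: "norm x = 1" "norm y = 1"
  shows "span {v1, v2} = {p. im x *v p = ip y *v p}"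
proof (rule set_eqI)
  fix q
  let ?A = "im x + ip y"
  have "?A *v (?A *v q) = - ((v1 \<bullet> q) *\<^sub>R v1 + (v2 \<bullet> q) *\<^sub>R v2)"
    unfolding v(4)[symmetric] wedge_mult using v(1-3)
    by (simp add: inner_diff_right inner_commute[of v2 v1])
  then have 1: "q \<in> span {v1, v2} \<longleftrightarrow> ?A *v (?A *v q) = - q"
    unfolding span_orthonormal_iff[OF v(1-3)] by (metis neg_equal_iff_equal)
  have 2: "?A *v (?A *v q) = - (1/2) *\<^sub>R q + 2 *\<^sub>R (im x *v (ip y *v q))"
    using xy
    by (simp add: matrix_vector_mult_add_rdistrib matrix_vector_right_distrib im_im ip_ip im_ip norm_eq_1)
      (simp add: scaleR_2 flip: scaleR_add_left)
  have "?A *v (?A *v q) = - q \<longleftrightarrow> im x *v (ip y *v q) = - (1/4) *\<^sub>R q"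
  proof -
    have "- (1/2) *\<^sub>R q + 2 *\<^sub>R z = - q \<longleftrightarrow> z = - (1/4) *\<^sub>R q" for z
      unfolding vec_eq_iff by (intro iff_allI) auto
    then show ?thesis unfolding 2 .
  qed
  also have "\<dots> \<longleftrightarrow> im x *v q = ip y *v q"
  proof
    assume "im x *v (ip y *v q) = - (1/4) *\<^sub>R q"
    then have "im x *v (im x *v (ip y *v q)) = im x *v (- (1/4) *\<^sub>R q)" by simp
    then show "im x *v q = ip y *v q"
      unfolding im_im matrix_vector_mult_scaleR using xy by (simp add: norm_eq_1)
  next
    assume "im x *v q = ip y *v q"
    then have "im x *v (ip y *v q) = im x *v (im x *v q)" by simp
    then show "im x *v (ip y *v q) = - (1/4) *\<^sub>R q"
      unfolding im_im using xy by (simp add: norm_eq_1)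
  qed
  finally show "q \<in> span {v1, v2} \<longleftrightarrow> q \<in> {p. im x *v p = ip y *v p}" using 1 by simp
qed

text \<open>The choice in \<open>plane\<close> is harmless: by \<open>span_eq_kernel\<close> every
  orthonormal pair representing the 2-vector spans the same kernel, and \<open>kernel_exists\<close>
  supplies such a pair.\<close>

lemma
  assumes "norm x = 1" "norm y = 1"
  shows simple_unit_im_ip: "simple_unit (im x + ip y)"
    and plane_im_ip: "plane (im x + ip y) = {p. im x *v p = ip y *v p}"
proof -
  obtain p where p: "p \<bullet> p = 1" "im x *v p = ip y *v p" using kernel_exists[OF assms] .
  then have *: "\<exists>v1 v2. v1 \<bullet> v1 = 1 \<and> v2 \<bullet> v2 = 1 \<and> v1 \<bullet> v2 = 0 \<and> wedge v1 v2 = im x + ip y"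
    using wedge_eq[OF p] orthonormal_tangent[OF p(1) assms(1)] by blast
  then show "simple_unit (im x + ip y)" unfolding simple_unit_def .
  have "\<exists>P v1 v2. v1 \<bullet> v1 = 1 \<and> v2 \<bullet> v2 = 1 \<and> v1 \<bullet> v2 = 0 \<and> wedge v1 v2 = im x + ip y \<and> P = span {v1, v2}"
    using * by blast
  from someI_ex[OF this] show "plane (im x + ip y) = {p. im x *v p = ip y *v p}"
    unfolding plane_def[symmetric] using span_eq_kernel[OF _ _ _ _ assms] by blast
qed

lemma kernel_eq_span:
  assumes "norm x = 1" "norm y = 1" "p \<bullet> p = 1" "im x *v p = ip y *v p"
  shows "{q. im x *v q = ip y *v q} = span {p, -2 *\<^sub>R (im x *v p)}"
  using span_eq_kernel[OF assms(3) orthonormal_tangent[OF assms(3,1)] wedge_eq[OF assms(3,4)] assms(1,2)]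
  by simp

section \<open>The fibration of a length decreasing map\<close>

text \<open>Here f is the ambient extension of g read through \<open>im\<close> and
  \<open>cp\<close>. Both spheres are scaled by the same factor, so the length bound survives the
  passage to unit spheres.\<close>

lemma length_decreasing_coordinates:
  assumes "smooth_strictly_length_decreasing g"
  obtains V f f' where "open V" "sphere 0 1 \<subseteq> V" "\<And>n. Dk n V f"
    "\<And>x. x \<in> V \<Longrightarrow> (f has_derivative f' x) (at x)"
    "\<And>x. norm x = 1 \<Longrightarrow> norm (f x) = 1"
    "\<And>x. norm x = 1 \<Longrightarrow> g (im x) = ip (f x)"
    "\<And>x w. norm x = 1 \<Longrightarrow> x \<bullet> w = 0 \<Longrightarrow> w \<noteq> 0 \<Longrightarrow> norm (f' x w) < norm w"
proof -
  obtain U G G' where U: "open U" "S2minus \<subseteq> U" "Cinf_on U G" and Gg: "\<And>x. x \<in> S2minus \<Longrightarrow> G x = g x"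
    and G': "\<And>x. x \<in> U \<Longrightarrow> (G has_derivative G' x) (at x)"
    and decr: "\<And>x w. x \<in> S2minus \<Longrightarrow> w \<in> tan_S2minus x \<Longrightarrow> w \<noteq> 0 \<Longrightarrow> bv_norm (G' x w) < bv_norm w"
    using assms unfolding smooth_strictly_length_decreasing_def by blast
  have gS: "\<And>x. x \<in> S2minus \<Longrightarrow> g x \<in> S2plus"
    using assms unfolding smooth_strictly_length_decreasing_def by blast
  have S: "im x \<in> S2minus" if "norm x = 1" for x using that by (simp add: S2minus_eq)
  define f where "f x = cp (G (im x))" for x
  define f' where "f' x w = cp (G' (im x) (im w))" for x w
  have f: "norm (f x) = 1 \<and> g (im x) = ip (f x)" if x: "norm x = 1" for x
  proof -
    obtain y where "g (im x) = ip y" "norm y = 1" using gS[OF S[OF x]] by (auto simp: S2plus_eq)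
    then show ?thesis using Gg[OF S[OF x]] by (simp add: f_def)
  qed
  show thesis
  proof (rule that[of "im -` U" f f'])
    show "open (im -` U)"
      using U(1) bounded_linear.continuous_on[OF bounded_linear_im continuous_on_id]
      by (intro open_vimage) (auto simp: id_def)
    show "sphere 0 1 \<subseteq> im -` U" by (intro subsetI vimageI2 subsetD[OF U(2)] S) simp
    show "Dk n (im -` U) f" for n
      unfolding f_def
      by (rule Dk_linear[OF bounded_linear_cp Dk_compose[OF Dk_linear[OF bounded_linear_im Dk_id]]])
        (use U(3) in \<open>auto simp: Cinf_on_iff_Dk\<close>)
    show "(f has_derivative f' x) (at x)" if "x \<in> im -` U" for x
      unfolding f_def f'_def
      by (rule bounded_linear.has_derivative[OF bounded_linear_cp
            has_derivative_compose[OF bounded_linear_imp_has_derivative[OF bounded_linear_im] G']])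
        (use that in auto)
    show "norm (f' x w) < norm w" if w: "norm x = 1" "x \<bullet> w = 0" "w \<noteq> 0" for x w
    proof -
      have "im w \<noteq> 0" using w(3) cm_im[of w] linear_0[OF bounded_linear.linear[OF bounded_linear_cm]] by metis
      then have "bv_norm (G' (im x) (im w)) < bv_norm (im w)"
        using decr[OF S[OF w(1)]] w(2) by (simp add: tan_S2minus_eq)
      then have "sqrt 2 * bv_norm (G' (im x) (im w)) < norm w"
        by (simp add: bv_norm_im field_simps)
      then show ?thesis using norm_cp_le[of "G' (im x) (im w)"] by (simp add: f'_def)
    qed
  qed (use f in auto)
qed

section \<open>Orthogonal complex structures on R^4\<close>

lemma minus_matrix_mult:
  fixes A B :: "real^'n^'n" and v :: "real^'n"
  shows "(- A) ** B = - (A ** B)" "A ** (- B) = - (A ** B)" "(- A) *v v = - (A *v v)"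
  by (simp_all add: matrix_matrix_mult_def matrix_vector_mult_def vec_eq_iff sum_negf)

text \<open>Orthogonality and J^2 = -1 make J antisymmetric, so J = im a + ip b. The square being
  scalar forces the cross term (im a)(ip b) to be a scalar \<kappa>. Multiplying once more by
  \<open>im a\<close> equates a multiple of \<open>ip b\<close> with a multiple of
  \<open>im a\<close>; since the two eigenspaces meet only in 0, |a|^2 b = 0.\<close>

lemma orthogonal_square_minus_one_cases:
  assumes "hopf_matrix J"
  obtains a where "J = im a" | b where "J = ip b"
proof -
  have J: "transpose J ** J = mat 1" "J ** J = - mat 1"
    using assms by (auto simp: hopf_matrix_def orthogonal_matrix_def)
  have "transpose J = - (transpose J ** (J ** J))"
    by (simp add: J(2) minus_matrix_mult)
  also have "\<dots> = - J" by (simp add: matrix_mul_assoc J(1))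
  finally have "J \<in> Lambda2" by (simp add: Lambda2_def)
  then have Jab: "J = im (cm J) + ip (cp J)" using Lambda2_decompose by metis
  define a b where "a = cm J" and "b = cp J"
  have Jab': "J = im a + ip b" using Jab by (simp add: a_def b_def)
  define \<kappa> where "\<kappa> = ((a \<bullet> a + b \<bullet> b) / 4 - 1) / 2"
  have ab: "im a *v (ip b *v p) = \<kappa> *\<^sub>R p" for p
  proof -
    have "- p = J *v (J *v p)" by (simp add: matrix_vector_mul_assoc J(2) minus_matrix_mult)
    also have "\<dots> = - ((a \<bullet> a + b \<bullet> b) / 4) *\<^sub>R p + 2 *\<^sub>R (im a *v (ip b *v p))"
      unfolding Jab'
      by (simp add: matrix_vector_mult_add_rdistrib matrix_vector_right_distrib im_im ip_ip im_ip)
        (simp add: scaleR_2 algebra_simps add_divide_distrib)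
    finally have eq: "- p = - ((a \<bullet> a + b \<bullet> b) / 4) *\<^sub>R p + 2 *\<^sub>R (im a *v (ip b *v p))" .
    have "- p $ i = - ((a \<bullet> a + b \<bullet> b) / 4) * p $ i + 2 * (im a *v (ip b *v p)) $ i" for i
      using arg_cong[OF eq, of "\<lambda>v. v $ i"] by simp
    then show ?thesis by (simp add: vec_eq_iff \<kappa>_def field_simps)
  qed
  have "(- ((a \<bullet> a) / 4) *\<^sub>R ip b) *v p = (\<kappa> *\<^sub>R im a) *v p" for p
    using im_im[of a "ip b *v p"] by (simp add: ab matrix_vector_mult_scaleR scaleR_matrix_vector_assoc)
  then have "- ((a \<bullet> a) / 4) *\<^sub>R ip b = \<kappa> *\<^sub>R im a" by (simp add: matrix_eq)
  then have "cp (- ((a \<bullet> a) / 4) *\<^sub>R ip b) = cp (\<kappa> *\<^sub>R im a)" by simp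
  then have "(a \<bullet> a) *\<^sub>R b = 0"
    by (simp add: linear_scale[OF bounded_linear.linear[OF bounded_linear_cp]]
        linear_neg[OF bounded_linear.linear[OF bounded_linear_cp]])
  then have "a = 0 \<or> b = 0" by auto
  then show thesis
    using Jab that linear_0[OF bounded_linear.linear[OF bounded_linear_im]]
      linear_0[OF bounded_linear.linear[OF bounded_linear_ip]]
    unfolding a_def b_def by (metis add.left_neutral add.right_neutral)
qed

section \<open>Geometry of the fibration in coordinates\<close>

text \<open>This separates analysis from geometry: the strict length bound survives only as the
  unique solution u and its smoothness. On S^3 the map u is \<open>gproj g\<close> in coordinates,
  but it lives on the open set of nonzero vectors, where it can be differentiated.\<close>

locale length_decreasing_map =
  fixes g :: "real^4^4 \<Rightarrow> real^4^4" and f :: "real^3 \<Rightarrow> real^3"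
    and f' :: "real^3 \<Rightarrow> real^3 \<Rightarrow> real^3" and u :: "real^4 \<Rightarrow> real^3"
  assumes f_sphere: "norm x = 1 \<Longrightarrow> norm (f x) = 1"
    and f_deriv: "norm x = 1 \<Longrightarrow> (f has_derivative f' x) (at x)"
    and g_im: "norm x = 1 \<Longrightarrow> g (im x) = ip (f x)"
    and u_norm: "p \<noteq> 0 \<Longrightarrow> norm (u p) = 1"
    and u_iff: "p \<noteq> 0 \<Longrightarrow> norm x = 1 \<Longrightarrow> im x *v p = ip (f x) *v p \<longleftrightarrow> x = u p"
    and u_Dk: "Dk n (-{0}) u"
begin

lemma S3_nonzero: "p \<in> S3 \<Longrightarrow> p \<noteq> 0" and S3_inner: "p \<in> S3 \<longleftrightarrow> p \<bullet> p = 1"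
  by (auto simp: S3_def norm_eq_1)

lemma u_kernel: "p \<noteq> 0 \<Longrightarrow> im (u p) *v p = ip (f (u p)) *v p"
  using u_iff u_norm by blast

lemma plane_g:
  assumes "norm x = 1"
  shows "plane (im x + g (im x)) = {p. im x *v p = ip (f x) *v p}"
  using plane_im_ip[OF assms f_sphere[OF assms]] by (simp add: g_im assms)

lemma mem_plane_iff:
  assumes "p \<in> S3"
  shows "x \<in> S2minus \<and> p \<in> plane (x + g x) \<longleftrightarrow> x = im (u p)"
proof
  assume "x \<in> S2minus \<and> p \<in> plane (x + g x)"
  then obtain v where "x = im v" "norm v = 1" "p \<in> plane (im v + g (im v))" by (auto simp: S2minus_eq)
  then show "x = im (u p)" using u_iff[OF S3_nonzero[OF assms]] by (simp add: plane_g)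
next
  assume "x = im (u p)"
  then show "x \<in> S2minus \<and> p \<in> plane (x + g x)"
    using u_norm u_kernel S3_nonzero[OF assms] by (simp add: plane_g S2minus_eq)
qed

lemma gproj_eq: "p \<in> S3 \<Longrightarrow> gproj g p = im (u p)"
  unfolding gproj_def using mem_plane_iff by simp

lemma u_surj:
  assumes "norm x = 1"
  obtains p where "p \<in> S3" "u p = x"
proof -
  obtain p where "p \<bullet> p = 1" "im x *v p = ip (f x) *v p" using kernel_exists[OF assms f_sphere[OF assms]] .
  then show thesis using that[of p] u_iff[OF _ assms, of p] by (force simp: S3_inner)
qed

lemma gfield_eq:
  assumes p: "p \<in> S3"
  shows "gfield g p = -2 *\<^sub>R (im (u p) *v p)"
  unfolding gfield_def
proof (rule the_equality)
  have p1: "p \<bullet> p = 1" "norm (u p) = 1" using p u_norm S3_nonzero by (auto simp: S3_inner)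
  have g: "gproj g p + g (gproj g p) = im (u p) + ip (f (u p))"
    using p p1 by (simp add: gproj_eq g_im)
  show "(-2 *\<^sub>R (im (u p) *v p)) \<bullet> p = 0 \<and> (-2 *\<^sub>R (im (u p) *v p)) \<bullet> (-2 *\<^sub>R (im (u p) *v p)) = 1 \<and>
      wedge p (-2 *\<^sub>R (im (u p) *v p)) = gproj g p + g (gproj g p)"
    unfolding g
    using orthonormal_tangent[OF p1] wedge_eq[OF p1(1) u_kernel[OF S3_nonzero[OF p]]]
    by (metis inner_commute)
  fix w assume w: "w \<bullet> p = 0 \<and> w \<bullet> w = 1 \<and> wedge p w = gproj g p + g (gproj g p)"
  \<comment> \<open>Contracting the wedge with p isolates w, so the conditions determine w
    uniquely.\<close>
  have "- w = wedge p w *v p" using w p1 by (subst wedge_mult) simp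
  also have "\<dots> = (im (u p) + ip (f (u p))) *v p" using w g by simp
  also have "\<dots> = 2 *\<^sub>R (im (u p) *v p)"
    using u_kernel[OF S3_nonzero[OF p]] by (simp add: matrix_vector_mult_add_rdistrib scaleR_2)
  finally have "- (- w) = - (2 *\<^sub>R (im (u p) *v p))" by (rule arg_cong)
  then show "w = -2 *\<^sub>R (im (u p) *v p)" by simp
qed

lemma gfield_Dk: "Dk n (-{0}) (\<lambda>p. -2 *\<^sub>R (im (u p) *v p))"
  by (intro Dk_scaleR Dk_const Dk_bilinear[OF bounded_bilinear_matrix_vector_mult]
      Dk_linear[OF bounded_linear_im u_Dk] Dk_id)

lemma smooth_gfield: "smooth_map S3 (gfield g)"
  unfolding smooth_map_def
proof (intro exI conjI)
  show "open (-{0::real^4})" by auto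
  show "S3 \<subseteq> -{0}" using S3_nonzero by auto
  show "Cinf_on (-{0}) (\<lambda>p. -2 *\<^sub>R (im (u p) *v p))" using gfield_Dk by (auto simp: Cinf_on_iff_Dk)
  show "\<forall>p\<in>S3. -2 *\<^sub>R (im (u p) *v p) = gfield g p" by (simp add: gfield_eq)
qed

text \<open>The kernel equation is linear in p. The consequence needed later is that the derivative
  of u vanishes in the radial direction.\<close>

lemma u_scale:
  assumes "p \<noteq> 0" "s \<noteq> 0"
  shows "u (s *\<^sub>R p) = u p"
proof -
  have "im (u p) *v (s *\<^sub>R p) = ip (f (u p)) *v (s *\<^sub>R p)"
    using u_kernel[OF assms(1)] by (simp add: matrix_vector_mult_scaleR)
  then show ?thesis using u_iff[of "s *\<^sub>R p" "u p"] assms u_norm by simp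
qed

text \<open>The curve q(t) = - A(t) A(0) p, where A(t) is the 2-vector over a curve x(t) of base points through
  u p, starts at p and stays in the plane of A(t), so u (q(t)) = x(t).\<close>

lemma u_derivative_onto:
  assumes p: "p \<in> S3" and u': "(u has_derivative u') (at p)" and z: "u p \<bullet> z = 0"
  shows "\<exists>h. h \<bullet> p = 0 \<and> u' h = z"
proof (cases "z = 0")
  case True
  then show ?thesis using linear_0[OF has_derivative_linear[OF u']] by (intro exI[of _ 0]) simp
next
  case False
  define w where "w = z /\<^sub>R norm z"
  have p0: "p \<noteq> 0" using p S3_nonzero by blast
  have nu: "norm (u p) = 1" using u_norm p0 by blast
  have "norm w = 1" using False by (simp add: w_def)
  then have w: "w \<bullet> w = 1" "u p \<bullet> w = 0" "u p \<bullet> u p = 1"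
    using z nu by (simp_all add: norm_eq_1) (simp add: w_def)
  define x where "x t = cos t *\<^sub>R u p + sin t *\<^sub>R w" for t
  have nx: "norm (x t) = 1" for t
    unfolding norm_eq_1 x_def
    by (simp add: inner_add_left inner_add_right w inner_commute[of w "u p"] flip: power2_eq_square)
  have x0: "x 0 = u p" by (simp add: x_def)
  have x': "(x has_derivative (\<lambda>t. t *\<^sub>R w)) (at 0)"
    unfolding x_def by (auto intro!: derivative_eq_intros)
  \<comment> \<open>This is - A(0) p: by the kernel equation both halves of A(0) p coincide. Hence
    q(t) below is A(t) e.\<close>
  define e where "e = -2 *\<^sub>R (im (u p) *v p)"
  define q where "q t = im (x t) *v e + ip (f (x t)) *v e" for t
  have q0: "q 0 = p"
  proof -
    have "im (u p) *v e = (1/2) *\<^sub>R p"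
      unfolding e_def matrix_vector_mult_scaleR im_im using w(3) by simp
    moreover have "ip (f (u p)) *v e = (1/2) *\<^sub>R p"
      unfolding e_def matrix_vector_mult_scaleR u_kernel[OF p0] ip_ip
      using f_sphere[OF nu] by (simp add: norm_eq_1)
    ultimately show ?thesis by (simp add: q_def x0 flip: scaleR_add_left)
  qed
  \<comment> \<open>The factorisation behind \<open>kernel_exists\<close>: the range of im x + ip y
    lies in the kernel of im x - ip y.\<close>
  have ker: "im (x t) *v q t = ip (f (x t)) *v q t" for t
    unfolding q_def matrix_vector_right_distrib im_im ip_ip im_ip
    using nx[of t] f_sphere[OF nx, of t] by (simp add: norm_eq_1)
  have fx: "((\<lambda>t. f (x t)) has_derivative (\<lambda>t. f' (u p) (t *\<^sub>R w))) (at 0)"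
    using has_derivative_compose[OF x', of f "f' (u p)"] f_deriv[OF nu] by (simp add: x0)
  define q' where "q' t = im (t *\<^sub>R w) *v e + ip (f' (u p) (t *\<^sub>R w)) *v e" for t
  have bl: "bounded_linear (\<lambda>A. A *v e)" for e :: "real^4"
    by (rule bounded_bilinear.bounded_linear_left[OF bounded_bilinear_matrix_vector_mult])
  have q': "(q has_derivative q') (at 0)"
    unfolding q_def q'_def
    by (intro has_derivative_add bounded_linear.has_derivative[OF bl]
        bounded_linear.has_derivative[OF bounded_linear_im x']
        bounded_linear.has_derivative[OF bounded_linear_ip fx])
  then have "isCont q 0" using has_derivative_continuous by blast
  then have "eventually (\<lambda>t. q t \<noteq> 0) (at 0)"
    using tendsto_imp_eventually_ne[of q p "at 0" 0] p0 q0 by (simp add: isCont_def)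
  moreover have u_q: "x t = u (q t)" if "q t \<noteq> 0" for t
    using u_iff[OF that nx[of t]] ker[of t] by simp
  ultimately have ev: "eventually (\<lambda>t. x t = u (q t)) (at 0)"
    by (rule eventually_mono)
  have "((\<lambda>t. u (q t)) has_derivative (\<lambda>t. u' (q' t))) (at 0)"
    using has_derivative_compose[OF q', of u u'] u' by (simp add: q0)
  moreover have "((\<lambda>t. u (q t)) has_derivative (\<lambda>t. t *\<^sub>R w)) (at 0)"
    by (rule has_derivative_transform_eventually[OF x' ev]) (use u_q[of 0] q0 p0 in auto)
  ultimately have "(\<lambda>t. u' (q' t)) = (\<lambda>t. t *\<^sub>R w)" by (rule has_derivative_unique)
  then have uq: "u' (q' 1) = w" by (metis scaleR_one)
  \<comment> \<open>The velocity of q need not be tangent to S^3. As the derivative of u kills p,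
    subtracting the radial part of the velocity leaves its image unchanged.\<close>
  have up: "u' p = 0"
  proof -
    have "((\<lambda>s. s *\<^sub>R p) has_derivative (\<lambda>s. s *\<^sub>R p)) (at (1::real))" by (auto intro!: derivative_eq_intros)
    from has_derivative_compose[OF this, of u u'] u'
    have "((\<lambda>s. u (s *\<^sub>R p)) has_derivative (\<lambda>s. u' (s *\<^sub>R p))) (at (1::real))" by simp
    moreover have "((\<lambda>s. u (s *\<^sub>R p)) has_derivative (\<lambda>s. 0)) (at (1::real))"
      by (rule has_derivative_transform_within_open[of "\<lambda>s. u p" _ 1 UNIV "-{0}"]) (auto simp: u_scale p0)
    ultimately have "(\<lambda>s. u' (s *\<^sub>R p)) = (\<lambda>s. 0)" by (rule has_derivative_unique)
    then show ?thesis by (metis scaleR_one)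
  qed
  have lin: "linear u'" using has_derivative_linear[OF u'] .
  define h where "h = norm z *\<^sub>R (q' 1 - (q' 1 \<bullet> p) *\<^sub>R p)"
  have "h \<bullet> p = 0" using p by (simp add: h_def inner_diff_left S3_inner)
  moreover have "u' h = z"
    using False by (simp add: h_def linear_scale[OF lin] linear_diff[OF lin] up uq) (simp add: w_def)
  ultimately show ?thesis by blast
qed

lemma smooth_submersion_gproj: "smooth_submersion (gproj g)"
proof -
  obtain u' where u': "\<And>p. p \<in> -{0} \<Longrightarrow> (u has_derivative u' p) (at p)"
    using u_Dk[of "Suc 0"] by auto
  have tangent: "u p \<bullet> u' p h = 0" if p: "p \<in> S3" for p h
  proof -
    have p0: "p \<in> -{0}" using p S3_nonzero by blast
    have "((\<lambda>q. u q \<bullet> u q) has_derivative (\<lambda>h. u p \<bullet> u' p h + u' p h \<bullet> u p)) (at p)"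
      using has_derivative_inner[OF u'[OF p0] u'[OF p0]] .
    moreover have "((\<lambda>q. u q \<bullet> u q) has_derivative (\<lambda>h. 0)) (at p)"
      by (rule has_derivative_transform_within_open[of "\<lambda>q. 1" _ p UNIV "-{0}"])
        (use p0 u_norm in \<open>auto simp: norm_eq_1\<close>)
    ultimately have "(\<lambda>h. u p \<bullet> u' p h + u' p h \<bullet> u p) = (\<lambda>h. 0)" by (rule has_derivative_unique)
    then show ?thesis by (auto simp: inner_commute dest: fun_cong[of _ _ h])
  qed
  show ?thesis
    unfolding smooth_submersion_def
  proof (intro conjI exI)
    show "gproj g ` S3 \<subseteq> S2minus" using gproj_eq u_norm S3_nonzero by (auto simp: S2minus_eq)
    show "open (-{0::real^4})" by auto
    show "S3 \<subseteq> -{0}" using S3_nonzero by auto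
    show "Cinf_on (-{0}) (\<lambda>p. im (u p))"
      using Dk_linear[OF bounded_linear_im u_Dk] by (auto simp: Cinf_on_iff_Dk)
    show "\<forall>p\<in>S3. im (u p) = gproj g p" by (simp add: gproj_eq)
    show "\<forall>p\<in>-{0}. ((\<lambda>p. im (u p)) has_derivative (\<lambda>h. im (u' p h))) (at p)"
      using bounded_linear.has_derivative[OF bounded_linear_im u'] by blast
    show "\<forall>p\<in>S3. (\<lambda>h. im (u' p h)) ` tan_S3 p = tan_S2minus (gproj g p)"
    proof
      fix p assume p: "p \<in> S3"
      have "u' p ` tan_S3 p = {z. u p \<bullet> z = 0}"
        using tangent[OF p] u_derivative_onto[OF p u'] S3_nonzero[OF p]
        unfolding tan_S3_def by (auto simp: image_iff)
      then show "(\<lambda>h. im (u' p h)) ` tan_S3 p = tan_S2minus (gproj g p)"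
        by (simp add: gproj_eq[OF p] tan_S2minus_eq flip: image_image)
    qed
  qed
qed

lemma fibre_eq:
  assumes p: "p \<in> S3"
  shows "{q\<in>S3. gproj g q = gproj g p} = span {p, -2 *\<^sub>R (im (u p) *v p)} \<inter> S3"
proof -
  have p1: "p \<bullet> p = 1" "norm (u p) = 1" using p u_norm S3_nonzero by (auto simp: S3_inner)
  have "gproj g q = gproj g p \<longleftrightarrow> im (u p) *v q = ip (f (u p)) *v q" if q: "q \<in> S3" for q
    using u_iff[OF S3_nonzero[OF q] p1(2)] by (simp add: gproj_eq p q) (metis cm_im)
  moreover have "{q. im (u p) *v q = ip (f (u p)) *v q} = span {p, -2 *\<^sub>R (im (u p) *v p)}"
    using kernel_eq_span[OF p1(2) f_sphere[OF p1(2)] p1(1) u_kernel[OF S3_nonzero[OF p]]] .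
  ultimately show ?thesis by blast
qed

lemma great_circle_fibre:
  assumes "x \<in> S2minus"
  shows "great_circle {p\<in>S3. gproj g p = x}"
proof -
  obtain v where v: "x = im v" "norm v = 1" using assms by (auto simp: S2minus_eq)
  then obtain p where p: "p \<in> S3" "u p = v" using u_surj by blast
  have p1: "p \<bullet> p = 1" "norm (u p) = 1" using p v by (auto simp: S3_inner)
  let ?w = "-2 *\<^sub>R (im (u p) *v p)"
  have w: "?w \<bullet> ?w = 1" "p \<bullet> ?w = 0" by (rule orthonormal_tangent[OF p1])+
  have "p \<noteq> ?w"
  proof
    assume "p = ?w"
    then show False using w(2) p1(1) by simp
  qed
  moreover have "independent {p, ?w}"
    using w p1 S3_nonzero[OF p(1)]
    by (intro pairwise_orthogonal_independent) (auto simp: pairwise_insert orthogonal_def inner_commute)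
  ultimately have "dim (span {p, ?w}) = 2" by (simp add: dim_eq_card_independent)
  then show ?thesis
    using fibre_eq[OF p(1)] p v unfolding great_circle_def by (auto simp: gproj_eq)
qed

section \<open>Constant maps and Hopf fibrations\<close>

text \<open>The kernel equation allows the field to be written with \<open>ip (f (u p))\<close> in
  place of \<open>im (u p)\<close>; for constant g that matrix no longer depends on p.\<close>

lemma constant_imp_gfield_eq:
  assumes "\<forall>x\<in>S2minus. g x = c"
  obtains b where "hopf_matrix (ip b)" "\<And>p. p \<in> S3 \<Longrightarrow> -2 *\<^sub>R (im (u p) *v p) = ip b *v p"
proof -
  obtain v :: "real^3" where v: "norm v = 1" using vector_choose_size[of 1] by auto
  define b where "b = -2 *\<^sub>R f v"
  have fv: "f x = f v" if "norm x = 1" for x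
    using assms g_im that v cp_ip by (metis S2minus_eq imageI mem_sphere_0)
  have bb: "b \<bullet> b = 4" using f_sphere[OF v] by (simp add: b_def norm_eq_1)
  have JJ: "ip b ** ip b = - mat 1"
    unfolding matrix_eq
    by (simp add: bb ip_ip minus_matrix_mult flip: matrix_vector_mul_assoc)
  moreover have "transpose (ip b) = - ip b" using ip_Lambda2 by (simp add: Lambda2_def)
  ultimately have "hopf_matrix (ip b)"
    unfolding hopf_matrix_def orthogonal_matrix_def by (simp add: minus_matrix_mult)
  moreover have "-2 *\<^sub>R (im (u p) *v p) = ip b *v p" if p: "p \<in> S3" for p
    using u_kernel[OF S3_nonzero[OF p]] fv[OF u_norm[OF S3_nonzero[OF p]]]
    by (simp add: b_def linear_scale[OF bounded_linear.linear[OF bounded_linear_ip]]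
        linear_neg[OF bounded_linear.linear[OF bounded_linear_ip]]
        scaleR_matrix_vector_assoc)
  ultimately show thesis by (rule that)
qed

lemma hopf_vector_field_iff: "hopf_vector_field (gfield g) \<longleftrightarrow> (\<exists>c. \<forall>x\<in>S2minus. g x = c)"
proof
  assume "\<exists>c. \<forall>x\<in>S2minus. g x = c"
  then obtain b where "hopf_matrix (ip b)" "\<And>p. p \<in> S3 \<Longrightarrow> -2 *\<^sub>R (im (u p) *v p) = ip b *v p"
    using constant_imp_gfield_eq by blast
  then show "hopf_vector_field (gfield g)" unfolding hopf_vector_field_def using gfield_eq by metis
next
  assume "hopf_vector_field (gfield g)"
  then obtain J where J: "hopf_matrix J" "\<And>p. p \<in> S3 \<Longrightarrow> -2 *\<^sub>R (im (u p) *v p) = J *v p"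
    unfolding hopf_vector_field_def using gfield_eq by metis
  have im_u: "im (-2 *\<^sub>R x) *v p = -2 *\<^sub>R (im x *v p)" "ip (-2 *\<^sub>R x) *v p = -2 *\<^sub>R (ip x *v p)" for x p
    by (simp_all add: linear_scale[OF bounded_linear.linear[OF bounded_linear_ip]]
        linear_neg[OF bounded_linear.linear[OF bounded_linear_ip]]
        linear_scale[OF bounded_linear.linear[OF bounded_linear_im]]
        linear_neg[OF bounded_linear.linear[OF bounded_linear_im]] scaleR_matrix_vector_assoc)
  show "\<exists>c. \<forall>x\<in>S2minus. g x = c"
  proof (rule orthogonal_square_minus_one_cases[OF J(1)])
    fix a assume a: "J = im a"
    have *: "-2 *\<^sub>R x = a" if x: "norm x = 1" for x
    proof -
      obtain p where p: "p \<in> S3" "u p = x" using u_surj[OF x] .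
      show ?thesis
        using J(2)[OF p(1)] im_vector_eq_iff[OF S3_nonzero[OF p(1)], of "-2 *\<^sub>R x" a] unfolding a p(2) im_u by blast
    qed
    \<comment> \<open>All unit vectors would equal the same multiple of a, which two antipodal ones
      contradict.\<close>
    obtain v :: "real^3" where v: "norm v = 1" using vector_choose_size[of 1] by auto
    have "-2 *\<^sub>R v = a" "-2 *\<^sub>R (- v) = a" using *[of v] *[of "- v"] v by simp_all
    then have "v = - v" by (metis scaleR_cancel_left neg_equal_0_iff_equal zero_neq_numeral)
    then have "v = 0" by (simp add: vec_eq_iff)
    then show ?thesis using v by simp
  next
    fix b assume b: "J = ip b"
    have *: "-2 *\<^sub>R f x = b" if x: "norm x = 1" for x
    proof -
      obtain p where p: "p \<in> S3" "u p = x" using u_surj[OF x] .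
      have "ip (-2 *\<^sub>R f x) *v p = ip b *v p"
        using J(2)[OF p(1)] u_kernel[OF S3_nonzero[OF p(1)]] unfolding b p(2) im_u by simp
      then show ?thesis using ip_vector_eq_iff[OF S3_nonzero[OF p(1)]] by blast
    qed
    have "f x = (-1/2) *\<^sub>R b" if "norm x = 1" for x
      unfolding *[OF that, symmetric] by simp
    then show ?thesis using g_im by (intro exI[of _ "ip ((-1/2) *\<^sub>R b)"]) (auto simp: S2minus_eq)
  qed
qed

text \<open>The fibres determine a Hopf field only up to sign at each point. For the converse
  direction the sign is shown to be constant on S^3, so the field of g is J or -J, and the claim
  reduces to \<open>hopf_vector_field_iff\<close>.\<close>

lemma hopf_fibration_iff: "hopf_fibration (gproj g) \<longleftrightarrow> (\<exists>c. \<forall>x\<in>S2minus. g x = c)"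
proof
  assume "\<exists>c. \<forall>x\<in>S2minus. g x = c"
  then obtain b where b: "hopf_matrix (ip b)" "\<And>p. p \<in> S3 \<Longrightarrow> -2 *\<^sub>R (im (u p) *v p) = ip b *v p"
    using constant_imp_gfield_eq by blast
  have "{q\<in>S3. gproj g q = gproj g p} = range (\<lambda>t. cos t *\<^sub>R p + sin t *\<^sub>R (ip b *v p))" if p: "p \<in> S3" for p
  proof -
    let ?w = "ip b *v p"
    have p1: "p \<bullet> p = 1" "norm (u p) = 1" using p u_norm S3_nonzero by (auto simp: S3_inner)
    have w: "?w \<bullet> ?w = 1" "p \<bullet> ?w = 0" using orthonormal_tangent[OF p1] unfolding b(2)[OF p] .
    have n: "(\<alpha> *\<^sub>R p + \<beta> *\<^sub>R ?w) \<bullet> (\<alpha> *\<^sub>R p + \<beta> *\<^sub>R ?w) = \<alpha>\<^sup>2 + \<beta>\<^sup>2" for \<alpha> \<beta>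
      using w p1 by (simp add: inner_add_left inner_add_right inner_commute[of ?w p] flip: power2_eq_square)
    show ?thesis
      unfolding fibre_eq[OF p] b(2)[OF p]
    proof (intro set_eqI iffI)
      fix q assume q: "q \<in> span {p, ?w} \<inter> S3"
      then have qe: "q = (p \<bullet> q) *\<^sub>R p + (?w \<bullet> q) *\<^sub>R ?w" using span_orthonormal_iff[OF p1(1) w] by blast
      have "(p \<bullet> q)\<^sup>2 + (?w \<bullet> q)\<^sup>2 = q \<bullet> q" using n qe by metis
      then have "(p \<bullet> q)\<^sup>2 + (?w \<bullet> q)\<^sup>2 = 1" using q by (simp add: S3_inner)
      then obtain t where "p \<bullet> q = cos t" "?w \<bullet> q = sin t" by (rule sincos_total_2pi)
      then show "q \<in> range (\<lambda>t. cos t *\<^sub>R p + sin t *\<^sub>R ?w)" using qe by auto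
    next
      fix q assume "q \<in> range (\<lambda>t. cos t *\<^sub>R p + sin t *\<^sub>R ?w)"
      then obtain t where t: "q = cos t *\<^sub>R p + sin t *\<^sub>R ?w" by blast
      then have "q \<in> S3" using n[of "cos t" "sin t"] by (simp add: S3_inner)
      moreover have "q \<in> span {p, ?w}" unfolding t by (intro span_add span_scale span_base) auto
      ultimately show "q \<in> span {p, ?w} \<inter> S3" by blast
    qed
  qed
  then show "hopf_fibration (gproj g)"
    unfolding hopf_fibration_def using smooth_submersion_gproj b(1) by blast
next
  assume "hopf_fibration (gproj g)"
  then obtain J where J: "hopf_matrix J"
    and fib: "\<And>p. p \<in> S3 \<Longrightarrow> {q\<in>S3. gproj g q = gproj g p} = range (\<lambda>t. cos t *\<^sub>R p + sin t *\<^sub>R (J *v p))"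
    unfolding hopf_fibration_def by auto
  define \<zeta> where "\<zeta> p = -2 *\<^sub>R (im (u p) *v p)" for p
  define s where "s p = \<zeta> p \<bullet> (J *v p)" for p
  have s: "J *v p = s p *\<^sub>R \<zeta> p \<and> (s p)\<^sup>2 = 1" if p: "p \<in> S3" for p
  proof -
    have p1: "p \<bullet> p = 1" "norm (u p) = 1" using p u_norm S3_nonzero by (auto simp: S3_inner)
    have w: "\<zeta> p \<bullet> \<zeta> p = 1" "p \<bullet> \<zeta> p = 0" using orthonormal_tangent[OF p1] unfolding \<zeta>_def by auto
    \<comment> \<open>The parameter pi/2 reaches J p, so J p lies in the fibre through p and hence
      in its plane.\<close>
    have "J *v p \<in> range (\<lambda>t. cos t *\<^sub>R p + sin t *\<^sub>R (J *v p))"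
      by (rule range_eqI[of _ _ "pi/2"]) simp
    then have Jp: "J *v p \<in> span {p, \<zeta> p}" "J *v p \<in> S3"
      using fib[OF p] fibre_eq[OF p] unfolding \<zeta>_def by auto
    \<comment> \<open>J is antisymmetric in either case of the classification, which leaves only the
      \<zeta> component of J p in the plane.\<close>
    have "p \<bullet> (J *v p) = 0"
    proof (rule orthogonal_square_minus_one_cases[OF J])
      show "p \<bullet> (J *v p) = 0" if "J = im a" for a
        using inner_im_self[of a p] that by (simp add: inner_commute)
      show "p \<bullet> (J *v p) = 0" if "J = ip a" for a
        using inner_ip_self[of a p] that by (simp add: inner_commute)
    qed
    then have e: "J *v p = s p *\<^sub>R \<zeta> p"
      using Jp(1) span_orthonormal_iff[OF p1(1) w] by (simp add: s_def)
    have "(J *v p) \<bullet> (J *v p) = (s p)\<^sup>2" unfolding e using w by (simp add: power2_eq_square)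
    then show ?thesis using e Jp(2) by (simp add: S3_inner)
  qed
  have "continuous_on S3 \<zeta>"
    unfolding \<zeta>_def using Dk_imp_continuous_on[OF gfield_Dk] S3_nonzero continuous_on_subset by blast
  then have cs: "continuous_on S3 s"
    unfolding s_def
    by (intro continuous_on_inner matrix_vector_mult_linear_continuous_on)
  \<comment> \<open>The sign s is continuous with values 1 and -1, so connectedness of the sphere
    makes it constant.\<close>
  have "connected S3" unfolding S3_def by (rule connected_sphere) simp
  then obtain \<sigma> where \<sigma>: "\<And>p. p \<in> S3 \<Longrightarrow> s p = \<sigma>"
  proof -
    have "s ` S3 \<subseteq> {1, -1}" using s by (auto simp: power2_eq_1_iff)
    then have "finite (s ` S3)" by (rule finite_subset) simp
    then have "s constant_on S3"
      using continuous_finite_range_constant[OF \<open>connected S3\<close> cs] by blast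
    then show thesis using that unfolding constant_on_def by blast
  qed
  obtain v :: "real^3" where "norm v = 1" using vector_choose_size[of 1] by auto
  then obtain p0 where "p0 \<in> S3" using u_surj by blast
  then have \<sigma>1: "\<sigma>\<^sup>2 = 1" using s \<sigma> by metis
  have "\<zeta> p = (\<sigma> *\<^sub>R J) *v p" if p: "p \<in> S3" for p
  proof -
    have "(\<sigma> *\<^sub>R J) *v p = \<sigma> *\<^sub>R (s p *\<^sub>R \<zeta> p)" using s[OF p] by (metis scaleR_matrix_vector_assoc)
    then show ?thesis using \<sigma>1 by (simp add: \<sigma>[OF p] power2_eq_square)
  qed
  moreover have "hopf_matrix (\<sigma> *\<^sub>R J)"
  proof -
    have "\<sigma> = 1 \<or> \<sigma> = -1" using \<sigma>1 by (simp add: power2_eq_1_iff)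
    moreover have "hopf_matrix (- J)"
      using J unfolding hopf_matrix_def orthogonal_matrix_def
      by (simp add: transpose_def vec_eq_iff matrix_matrix_mult_def)
    ultimately show ?thesis using J by auto
  qed
  ultimately have "hopf_vector_field (gfield g)"
    unfolding hopf_vector_field_def using gfield_eq \<zeta>_def by metis
  then show "\<exists>c. \<forall>x\<in>S2minus. g x = c" using hopf_vector_field_iff by blast
qed

end

text \<open>The fixed point family is taken with Q = \<open>rot\<close>; \<open>im_eq_ip_iff\<close>
  translates its fixed point equation into the kernel equation of the plane.\<close>

lemma length_decreasing_map_exists:
  assumes "smooth_strictly_length_decreasing g"
  shows "\<exists>f f' u. length_decreasing_map g f f' u"
proof -
  obtain V f f' where f: "open V" "sphere 0 1 \<subseteq> V" "\<And>n. Dk n V f"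
    "\<And>x. x \<in> V \<Longrightarrow> (f has_derivative f' x) (at x)"
    "\<And>x. norm x = 1 \<Longrightarrow> norm (f x) = 1"
    "\<And>x. norm x = 1 \<Longrightarrow> g (im x) = ip (f x)"
    "\<And>x w. norm x = 1 \<Longrightarrow> x \<bullet> w = 0 \<Longrightarrow> w \<noteq> 0 \<Longrightarrow> norm (f' x w) < norm w"
    using length_decreasing_coordinates[OF assms] by blast
  have "\<exists>u. (\<forall>p. p \<noteq> 0 \<longrightarrow> (\<forall>x. norm x = 1 \<and> rot p (f x) = (norm p)\<^sup>2 *\<^sub>R x \<longleftrightarrow> x = u p))
      \<and> (\<forall>n. Dk n (-{0}) u)"
    by (rule smooth_fixpoint_family[OF _ linear_rot norm_rot rot_Dk f(1-3,5,4,7)]) simp_all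
  then obtain u where u: "\<And>p x. p \<noteq> 0 \<Longrightarrow> norm x = 1 \<and> rot p (f x) = (norm p)\<^sup>2 *\<^sub>R x \<longleftrightarrow> x = u p"
    "\<And>n. Dk n (-{0}) u"
    by blast
  have "length_decreasing_map g f f' u"
  proof
    show "(f has_derivative f' x) (at x)" if "norm x = 1" for x using f(2,4) that by auto
    show "norm (u p) = 1" if "p \<noteq> 0" for p using u(1)[OF that] by blast
    show "im x *v p = ip (f x) *v p \<longleftrightarrow> x = u p" if "p \<noteq> 0" "norm x = 1" for p x
      using u(1)[OF that(1), of x] im_eq_ip_iff[OF that(1)] that(2) by blast
  qed (use f u in auto)
  then show ?thesis by blast
qed

text \<open>Disjointness and covering of the great circles together are the unique existence of x
  for each p. The same fact identifies the fibre of \<open>gproj g\<close> over x with the great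
  circle cut out by the plane of x + g x.\<close>

theorem mainTheorem8:
  fixes g :: "real^4^4 \<Rightarrow> real^4^4"
  assumes "smooth_strictly_length_decreasing g"
  shows "(\<forall>x\<in>S2minus. simple_unit (x + g x))
    \<and> (\<forall>p\<in>S3. \<exists>!x. x \<in> S2minus \<and> p \<in> plane (x + g x))
    \<and> smooth_map S3 (gfield g)
    \<and> smooth_submersion (gproj g)
    \<and> (\<forall>x\<in>S2minus. great_circle {p\<in>S3. gproj g p = x})
    \<and> (hopf_vector_field (gfield g) \<longleftrightarrow> (\<exists>c. \<forall>x\<in>S2minus. g x = c))
    \<and> (hopf_fibration (gproj g) \<longleftrightarrow> (\<exists>c. \<forall>x\<in>S2minus. g x = c))"
proof -
  obtain f f' u where "length_decreasing_map g f f' u" using length_decreasing_map_exists[OF assms] by blast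
  then interpret length_decreasing_map g f f' u .
  have "simple_unit (x + g x)" if "x \<in> S2minus" for x
    using that simple_unit_im_ip f_sphere by (auto simp: S2minus_eq g_im)
  moreover have "\<exists>!x. x \<in> S2minus \<and> p \<in> plane (x + g x)" if "p \<in> S3" for p
    using mem_plane_iff[OF that] by simp
  ultimately show ?thesis
    using smooth_gfield smooth_submersion_gproj great_circle_fibre hopf_vector_field_iff hopf_fibration_iff
    by blast
qed

end
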